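(* Let $\lambda$ and $\rho$ be partitions of $n\ge1$. The irreducible character value $\chi^\lambda_\rho$ of $S_n$ is given by $$\chi^{\lambda}_{\rho}=\sum_{\substack{\mu\vartriangleleft\rho,\ |\mu|\ge\lambda_1\\ \tau\vdash|\mu|-\lambda_1}}\frac{(-1)^{l(\tau)}}{z_\tau}\,\chi^{\lambda\setminus\lambda_1}_{(\rho\setminus\mu)\cup\tau},$$ summed over subpartitions $\mu$ of $\rho$ with weight at least $\lambda_1$ (one term for each subset of the set of positions of parts of $\rho$) and over partitions $\tau$ of $|\mu|-\lambda_1$.
   Context: $\chi^\lambda_\rho$ denotes the value of the irreducible character of the symmetric group $S_n$ indexed by the partition $\lambda$ (standard labelling: $\chi^{(n)}$ is trivial) at the class of cycle type $\rho$; the value for $n=0$ is $1$. For a partition $\rho=(\rho_1,\dots,\rho_l)$, a subpartition $\mu\vartriangleleft\rho$ is $\mu=\emptyset$ or $\mu=(\rho_{i_1},\dots,\rho_{i_s})$ with $1\le i_1<\dots<i_s\le l$ (there are $2^l$ of them, indexed by subsets of positions), and $\rho\setminus\mu$ is the partition formed by the remaining parts. $\mu\cup\tau$ is the partition whose parts are the parts of $\mu$ and of $\tau$ together. $\lambda\setminus\lambda_1$ is $\lambda$ with its largest part $\lambda_1$ deleted. $l(\tau)$ is the number of parts of $\tau$ and $z_\tau=\prod_i i^{m_i}m_i!$ for $\tau=(1^{m_1}2^{m_2}\cdots)$. *)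

theory Defs
  imports
    Complex_Main
    "HOL-Library.Multiset"
    "HOL-Library.Function_Algebras"
    "HOL-Combinatorics.Permutations"
    "HOL-Combinatorics.Orbits"
begin

section \<open>Partitions\<close>

definition partitions :: "nat \<Rightarrow> nat list set" where
  "partitions n = {lam. sorted_wrt (\<ge>) lam \<and> 0 \<notin> set lam \<and> sum_list lam = n}"

definition part_union :: "nat list \<Rightarrow> nat list \<Rightarrow> nat list" where
  "part_union mu tau = rev (sort (mu @ tau))"

definition part_z :: "nat list \<Rightarrow> nat" where
  "part_z tau = (\<Prod>i\<in>set tau. i ^ count (mset tau) i * fact (count (mset tau) i))"

lemma finite_partitions: "finite (partitions n)"
proof (rule finite_subset)
  show "partitions n \<subseteq> {xs. set xs \<subseteq> {0..n} \<and> length xs \<le> n}"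
  proof
    fix lam assume "lam \<in> partitions n"
    then have z: "0 \<notin> set lam" and s: "sum_list lam = n"
      by (auto simp: partitions_def)
    have "length lam \<le> sum_list lam"
      using z by (induction lam) auto
    moreover have "set lam \<subseteq> {0..n}"
      using s member_le_sum_list by fastforce
    ultimately show "lam \<in> {xs. set xs \<subseteq> {0..n} \<and> length xs \<le> n}"
      using s by simp
  qed
  show "finite {xs. set xs \<subseteq> {0..n} \<and> length xs \<le> n}"
    by (intro finite_lists_length_le) simp
qed


section \<open>The trace of an endomorphism of a finite-dimensional subspace\<close>

text \<open>The diagonal entries of the matrix of \<open>T\<close> are summed over some basis of \<open>V\<close>; for a
  finite-dimensional subspace \<open>V\<close> mapped linearly into itself by \<open>T\<close> the result does not
  depend on that basis.\<close>

definition (in vector_space) trace_on :: "'b set \<Rightarrow> ('b \<Rightarrow> 'b) \<Rightarrow> 'a" where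
  "trace_on V T =
    (let B = (SOME B. B \<subseteq> V \<and> independent B \<and> span B = V)
     in \<Sum>b\<in>B. representation B (T b) b)"


section \<open>The complex group algebra of the symmetric group\<close>

text \<open>\<open>S\<^sub>n\<close> consists of the permutations of \<open>{1..n}\<close>. An element of its group algebra is the
  coefficient function of a formal linear combination of permutations.\<close>

definition galg_scale :: "complex \<Rightarrow> ((nat \<Rightarrow> nat) \<Rightarrow> complex) \<Rightarrow> ((nat \<Rightarrow> nat) \<Rightarrow> complex)" where
  "galg_scale c x = (\<lambda>g. c * x g)"

interpretation galg: vector_space galg_scale
  by unfold_locales (auto simp: galg_scale_def fun_eq_iff algebra_simps)

definition galg_carrier :: "nat \<Rightarrow> ((nat \<Rightarrow> nat) \<Rightarrow> complex) set" where
  "galg_carrier n = {x. \<forall>g. \<not> g permutes {1..n} \<longrightarrow> x g = 0}"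

definition galg_single :: "(nat \<Rightarrow> nat) \<Rightarrow> ((nat \<Rightarrow> nat) \<Rightarrow> complex)" where
  "galg_single g = (\<lambda>h. if h = g then 1 else 0)"

definition galg_mult ::
  "nat \<Rightarrow> ((nat \<Rightarrow> nat) \<Rightarrow> complex) \<Rightarrow> ((nat \<Rightarrow> nat) \<Rightarrow> complex) \<Rightarrow> ((nat \<Rightarrow> nat) \<Rightarrow> complex)" where
  "galg_mult n x y =
    (\<lambda>g. \<Sum>(h, k) | h permutes {1..n} \<and> k permutes {1..n} \<and> h \<circ> k = g. x h * y k)"


section \<open>Irreducible characters of the symmetric group\<close>

text \<open>The irreducible representation of \<open>S\<^sub>n\<close> indexed by \<open>\<lambda>\<close> is the Specht module, realised as
  the left ideal of the group algebra generated by the Young symmetrizer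
  \<open>c\<^sub>\<lambda> = a\<^sub>\<lambda> b\<^sub>\<lambda>\<close> (Fulton and Harris, Representation Theory, Theorem 4.3). Here \<open>a\<^sub>\<lambda>\<close> is the sum
  of the row group and \<open>b\<^sub>\<lambda>\<close> the signed sum of the column group of the tableau in which
  \<open>1, \<dots>, n\<close> are written row by row. For \<open>\<lambda> = (n)\<close> this is the trivial representation.\<close>

text \<open>Rows of that tableau are numbered from 0, columns from 1. Both functions are meant for
  entries in \<open>{1..sum_list lam}\<close> only.\<close>

definition row_of :: "nat list \<Rightarrow> nat \<Rightarrow> nat" where
  "row_of lam i = (LEAST r. i \<le> sum_list (take (Suc r) lam))"

definition col_of :: "nat list \<Rightarrow> nat \<Rightarrow> nat" where
  "col_of lam i = i - sum_list (take (row_of lam i) lam)"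

definition row_group :: "nat list \<Rightarrow> (nat \<Rightarrow> nat) set" where
  "row_group lam = {p. p permutes {1..sum_list lam} \<and>
     (\<forall>i\<in>{1..sum_list lam}. row_of lam (p i) = row_of lam i)}"

definition col_group :: "nat list \<Rightarrow> (nat \<Rightarrow> nat) set" where
  "col_group lam = {q. q permutes {1..sum_list lam} \<and>
     (\<forall>i\<in>{1..sum_list lam}. col_of lam (q i) = col_of lam i)}"

definition young_symmetrizer :: "nat list \<Rightarrow> ((nat \<Rightarrow> nat) \<Rightarrow> complex)" where
  "young_symmetrizer lam = galg_mult (sum_list lam)
     (\<Sum>p\<in>row_group lam. galg_single p)
     (\<Sum>q\<in>col_group lam. galg_scale (of_int (sign q)) (galg_single q))"

definition specht_module :: "nat list \<Rightarrow> ((nat \<Rightarrow> nat) \<Rightarrow> complex) set" where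
  "specht_module lam =
     (\<lambda>x. galg_mult (sum_list lam) x (young_symmetrizer lam)) ` galg_carrier (sum_list lam)"

definition specht_character :: "nat list \<Rightarrow> (nat \<Rightarrow> nat) \<Rightarrow> complex" where
  "specht_character lam g =
     galg.trace_on (specht_module lam) (galg_mult (sum_list lam) (galg_single g))"

text \<open>Fixed points in \<open>{1..n}\<close> contribute parts equal to 1.\<close>

definition cycle_type :: "nat \<Rightarrow> (nat \<Rightarrow> nat) \<Rightarrow> nat multiset" where
  "cycle_type n g = image_mset card (mset_set (orbit g ` {1..n}))"

text \<open>The character value at a conjugacy class is its value at any representative. It is only
  meaningful when \<open>lam\<close> and \<open>rho\<close> are partitions of the same number.\<close>

definition chi :: "nat list \<Rightarrow> nat list \<Rightarrow> complex" where
  "chi lam rho = specht_character lam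
     (SOME g. g permutes {1..sum_list lam} \<and> cycle_type (sum_list lam) g = mset rho)"

end

theory Submission
  imports Defs
begin

text \<open>
  Let \<open>F\<^sub>\<lambda>\<close> be the function of cycle types defined by the recursion itself, starting from the empty
  partition. In terms of symmetric functions, \<open>F\<^sub>\<lambda>\<close> arises from the function of \<open>\<lambda>\<setminus>\<lambda>\<^sub>1\<close> by Bernstein's operator
  \<open>B\<^sub>m = \<Sum>\<^sub>i (-1)\<^sup>i h\<^bsub>m+i\<^esub> e\<^sub>i\<^sup>*\<close> with \<open>m = \<lambda>\<^sub>1\<close>, where the star denotes the adjoint. On the one hand,
  \<open>F\<^sub>\<lambda>\<close> is \<open>h\<^sub>\<lambda>\<close> plus a combination of the \<open>h\<^sub>\<alpha>\<close> with \<open>\<alpha>\<close> lexicographically larger than \<open>\<lambda>\<close>. On the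
  other hand \<open>\<Sum>\<^sub>i (-1)\<^sup>i e\<^sub>i\<^sup>* h\<^bsub>s-i\<^esub>\<^sup>* = 0\<close> for \<open>s > 0\<close> implies that the adjoint of \<open>h\<^sub>r\<close> kills \<open>F\<^sub>\<lambda>\<close>
  for \<open>r > \<lambda>\<^sub>1\<close> and removes the first part of \<open>\<lambda>\<close> for \<open>r = \<lambda>\<^sub>1\<close>; hence \<open>F\<^sub>\<lambda>\<close> has scalar product 1 with
  \<open>h\<^sub>\<lambda>\<close> and 0 with the larger \<open>h\<^sub>\<alpha>\<close>. The Specht character \<open>\<chi>\<^sub>\<lambda>\<close> has the same scalar products with these
  \<open>h\<^sub>\<alpha>\<close>, as the scalar product with \<open>h\<^sub>\<alpha>\<close> is the average over the row group of shape \<open>\<alpha>\<close>. So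
  \<open>F\<^sub>\<lambda>\<close> has norm 1 and scalar product 1 with \<open>\<chi>\<^sub>\<lambda>\<close>. As \<open>\<chi>\<^sub>\<lambda>\<close> also has norm 1, the difference has norm 0.
\<close>


section \<open>Splittings of a multiset\<close>

text \<open>This is the coproduct for which the power sums are primitive: all distributions of the
  elements of \<open>M\<close> over two sides, equal elements counted as distinguishable. The fold
  builds a functional of \<open>G\<close>, since each new element requires the previous functional
  at two different arguments.\<close>

definition msplit ::
  "('a multiset \<Rightarrow> 'a multiset \<Rightarrow> 'b::comm_monoid_add) \<Rightarrow> 'a multiset \<Rightarrow> 'b" where
  "msplit G M = fold_mset
     (\<lambda>x \<Phi> G. \<Phi> (\<lambda>A B. G (add_mset x A) B) + \<Phi> (\<lambda>A B. G A (add_mset x B)))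
     (\<lambda>G. G {#} {#}) M G"

lemma msplit_empty [simp]: "msplit G {#} = G {#} {#}"
  by (simp add: msplit_def)

lemma msplit_add_mset:
  fixes G :: "'a multiset \<Rightarrow> 'a multiset \<Rightarrow> 'b::comm_monoid_add"
  shows "msplit G (add_mset x M) =
     msplit (\<lambda>A B. G (add_mset x A) B) M + msplit (\<lambda>A B. G A (add_mset x B)) M"
proof -
  interpret comp_fun_commute
    "\<lambda>x (\<Phi> :: ('a multiset \<Rightarrow> 'a multiset \<Rightarrow> 'b) \<Rightarrow> 'b) G.
       \<Phi> (\<lambda>A B. G (add_mset x A) B) + \<Phi> (\<lambda>A B. G A (add_mset x B))"
    by unfold_locales (simp add: fun_eq_iff add_mset_commute add_ac)
  show ?thesis
    by (simp add: msplit_def)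
qed

lemma msplit_cong:
  "(\<And>A B. A + B = M \<Longrightarrow> G A B = H A B) \<Longrightarrow> msplit G M = msplit H M"
proof (induction M arbitrary: G H)
  case (add x M)
  show ?case
    unfolding msplit_add_mset by (intro arg_cong2[where f = "(+)"] add.IH add.prems) auto
qed simp

lemma msplit_add: "msplit (\<lambda>A B. G A B + H A B) M = msplit G M + msplit H M"
  by (induction M arbitrary: G H) (auto simp: msplit_add_mset add_ac)

lemma msplit_zero [simp]: "msplit (\<lambda>A B. 0) M = 0"
  by (induction M) (auto simp: msplit_add_mset)

lemma msplit_sum: "msplit (\<lambda>A B. \<Sum>i\<in>I. G i A B) M = (\<Sum>i\<in>I. msplit (G i) M)"
  by (induction I rule: infinite_finite_induct) (simp_all add: msplit_add)

lemma msplit_mult_left: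
  "msplit (\<lambda>A B. c * G A B) M = (c :: 'b::semiring_0) * msplit G M"
  by (induction M arbitrary: G) (auto simp: msplit_add_mset algebra_simps)

lemma msplit_minus: "msplit (\<lambda>A B. - G A B) M = - (msplit G M :: 'b::ab_group_add)"
  by (induction M arbitrary: G) (auto simp: msplit_add_mset algebra_simps)

lemma msplit_union:
  "msplit G (M + N) = msplit (\<lambda>A B. msplit (\<lambda>C D. G (A + C) (B + D)) N) M"
  by (induction M arbitrary: G) (auto simp: msplit_add_mset)

lemma msplit_only_empty_left:
  "msplit (\<lambda>A B. if A = {#} then f B else 0) M = f M"
  by (induction M arbitrary: f) (auto simp: msplit_add_mset)

text \<open>The binomial theorem: every element contributes one factor \<open>s + t\<close>.\<close>

lemma msplit_power_size:
  "msplit (\<lambda>A B. s ^ size A * t ^ size B) M = (s + t :: 'b::comm_semiring_1) ^ size M"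
proof (induction M)
  case (add x M)
  have "msplit (\<lambda>A B. s ^ size A * t ^ size B) (add_mset x M) =
    s * msplit (\<lambda>A B. s ^ size A * t ^ size B) M + t * msplit (\<lambda>A B. s ^ size A * t ^ size B) M"
    unfolding msplit_mult_left [symmetric] by (simp add: msplit_add_mset mult_ac)
  then show ?case
    using add by (simp add: algebra_simps)
qed simp

text \<open>Subsets are sorted by whether they contain 0. The rest is shifted down by one, which is
  the form in which \<open>nths_Cons\<close> recurses.\<close>

lemma sum_subsets_lessThan_Suc:
  "(\<Sum>I | I \<subseteq> {..<Suc n}. h I) =
     (\<Sum>I | I \<subseteq> {..<n}. h (insert 0 (Suc ` I))) + (\<Sum>I | I \<subseteq> {..<n}. (h (Suc ` I) :: 'b::comm_monoid_add))"
proof -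
  have eq: "{I. I \<subseteq> {..<Suc n}} =
      (\<lambda>I. insert 0 (Suc ` I)) ` {I. I \<subseteq> {..<n}} \<union> (\<lambda>I. Suc ` I) ` {I. I \<subseteq> {..<n}}"
  proof (intro equalityI subsetI)
    fix I assume "I \<in> {I. I \<subseteq> {..<Suc n}}"
    then have I: "I \<subseteq> {..<Suc n}" by simp
    define J where "J = {j. Suc j \<in> I}"
    have J: "J \<subseteq> {..<n}" using I by (auto simp: J_def)
    have S: "Suc ` J = I - {0}"
      by (auto simp: J_def image_iff) (metis not0_implies_Suc)
    have "I = insert 0 (Suc ` J) \<or> I = Suc ` J"
      unfolding S by blast
    with J show "I \<in> (\<lambda>I. insert 0 (Suc ` I)) ` {I. I \<subseteq> {..<n}} \<union> (\<lambda>I. Suc ` I) ` {I. I \<subseteq> {..<n}}"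
      by blast
  next
    fix I assume "I \<in> (\<lambda>I. insert 0 (Suc ` I)) ` {I. I \<subseteq> {..<n}} \<union> (\<lambda>I. Suc ` I) ` {I. I \<subseteq> {..<n}}"
    then show "I \<in> {I. I \<subseteq> {..<Suc n}}"
      by auto
  qed
  have fin: "finite {I. I \<subseteq> {..<n}}" for n :: nat
    by (metis finite_Collect_subsets finite_lessThan)
  have inj: "inj_on (\<lambda>I. insert (0::nat) (Suc ` I)) A" "inj_on (\<lambda>I. Suc ` I) A" for A
    by (rule inj_on_inverseI[where g = "\<lambda>J. {j. Suc j \<in> J}"]; auto)+
  show ?thesis
    unfolding eq by (subst sum.union_disjoint) (auto simp: fin sum.reindex inj)
qed

text \<open>This links the operators on multisets to the sum over sets of positions in the theorem,
  where repeated parts are counted separately.\<close>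

lemma msplit_mset:
  "msplit G (mset xs) =
     (\<Sum>I | I \<subseteq> {..<length xs}. G (mset (nths xs I)) (mset (nths xs (- I))))"
proof (induction xs arbitrary: G)
  case (Cons x xs)
  have 1: "{j. Suc j \<in> insert 0 (Suc ` I)} = I" "{j. Suc j \<in> Suc ` I} = I" for I
    by auto
  have 2: "{j. Suc j \<in> - insert 0 (Suc ` I)} = - I" "{j. Suc j \<in> - (Suc ` I)} = - I" for I
    by auto
  have 3: "0 \<notin> - insert 0 (Suc ` I)" "0 \<in> - (Suc ` I)" for I
    by auto
  show ?case
    by (simp add: sum_subsets_lessThan_Suc nths_Cons msplit_add_mset Cons.IH 1 2 3
        del: Compl_iff)
qed simp


section \<open>Averages over partitions\<close>

definition pmsets :: "nat \<Rightarrow> nat multiset set" where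
  "pmsets n = {M. 0 \<notin># M \<and> sum_mset M = n}"

definition mset_z :: "nat multiset \<Rightarrow> nat" where
  "mset_z M = (\<Prod>i\<in>set_mset M. i ^ count M i * fact (count M i))"

text \<open>The class of cycle type \<open>M\<close> has \<open>fact n / mset_z M\<close> elements,
  so this is the average of a class function over the symmetric group, as
  \<open>sum_permutes_ctype\<close> confirms. The average of a product is the scalar product of
  class functions.\<close>

definition pavg :: "nat \<Rightarrow> (nat multiset \<Rightarrow> 'a::field_char_0) \<Rightarrow> 'a" where
  "pavg n f = (\<Sum>M\<in>pmsets n. f M / of_nat (mset_z M))"

lemma bij_betw_mset_partitions: "bij_betw mset (partitions n) (pmsets n)"
proof (rule bij_betw_byWitness[where f' = "\<lambda>M. rev (sorted_list_of_multiset M)"])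
  show "\<forall>a\<in>partitions n. rev (sorted_list_of_multiset (mset a)) = a"
  proof
    fix a assume "a \<in> partitions n"
    then have "sorted (rev a)"
      by (simp add: partitions_def sorted_wrt_rev)
    then have "sort (rev a) = rev a"
      by (rule sorted_sort_id)
    moreover have "sort a = sort (rev a)"
      by (metis mset_rev properties_for_sort sorted_sort mset_sort)
    ultimately show "rev (sorted_list_of_multiset (mset a)) = a"
      by simp
  qed
  show "mset ` partitions n \<subseteq> pmsets n"
    by (auto simp: partitions_def pmsets_def sum_mset_sum_list)
  show "(\<lambda>M. rev (sorted_list_of_multiset M)) ` pmsets n \<subseteq> partitions n"
    by (auto simp: partitions_def pmsets_def sorted_wrt_rev simp flip: sum_mset_sum_list)
qed auto

lemma finite_pmsets [simp]: "finite (pmsets n)"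
  using bij_betw_finite[OF bij_betw_mset_partitions] finite_partitions by blast

lemma pavg_partitions:
  "pavg n f = (\<Sum>tau\<in>partitions n. f (mset tau) / of_nat (part_z tau))"
  unfolding pavg_def
  by (subst sum.reindex_bij_betw[OF bij_betw_mset_partitions, symmetric])
    (simp add: part_z_def mset_z_def)

lemma pmsets_0 [simp]: "pmsets 0 = {{#}}"
  by (auto simp: pmsets_def) (metis multiset_nonemptyE)

lemma mset_z_pos: "0 \<notin># M \<Longrightarrow> mset_z M > 0"
  by (auto simp: mset_z_def intro!: prod_pos) (metis neq0_conv)

lemma mset_z_add_mset: "mset_z (add_mset j M) = mset_z M * j * Suc (count M j)"
proof -
  let ?A = "set_mset M - {j}"
  let ?t = "\<lambda>M i. i ^ count M i * fact (count M i) :: nat"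
  have "mset_z (add_mset j M) = ?t (add_mset j M) j * prod (?t (add_mset j M)) ?A"
    unfolding mset_z_def by (subst prod.remove[where x = j]) auto
  also have "prod (?t (add_mset j M)) ?A = prod (?t M) ?A"
    by (rule prod.cong) auto
  also have "?t (add_mset j M) j = ?t M j * j * Suc (count M j)"
    by (simp add: algebra_simps)
  also have "?t M j * j * Suc (count M j) * prod (?t M) ?A =
      ?t M j * prod (?t M) ?A * j * Suc (count M j)"
    by (simp only: mult_ac)
  also have "?t M j * prod (?t M) ?A = mset_z M"
  \<comment> \<open>If \<open>j\<close> does not occur in \<open>M\<close>, its factor is 1, so the
    product without it is already \<open>mset_z M\<close>.\<close>
  proof (cases "j \<in># M")
    case True
    then show ?thesis
      unfolding mset_z_def by (subst prod.remove[where x = j]) auto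
  next
    case False
    then show ?thesis
      by (simp add: mset_z_def not_in_iff)
  qed
  finally show ?thesis .
qed

lemma sum_mset_conv_count: "sum_mset M = (\<Sum>j\<in>set_mset M. j * count M j :: nat)"
proof (induction M)
  case (add x M)
  have "(\<Sum>j\<in>set_mset (add_mset x M). j * count (add_mset x M) j) =
     (\<Sum>j\<in>insert x (set_mset M). j * count M j + (if j = x then x else 0))"
    by (auto intro!: sum.cong)
  also have "\<dots> = (\<Sum>j\<in>insert x (set_mset M). j * count M j) + x"
    by (simp add: sum.distrib)
  also have "(\<Sum>j\<in>insert x (set_mset M). j * count M j) = (\<Sum>j\<in>set_mset M. j * count M j)"
    by (rule sum.mono_neutral_right) (auto simp: not_in_iff)
  finally show ?case using add by simp
qed simp

lemma pavg_0 [simp]: "pavg 0 f = f {#}"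
  by (simp add: pavg_def mset_z_def)

lemma pavg_Newton:
  "of_nat n * pavg n f = (\<Sum>j\<in>{1..n}. pavg (n - j) (\<lambda>M. f (add_mset j M)))"
proof -
  have "(\<Sum>j\<in>{1..n}. pavg (n - j) (\<lambda>M. f (add_mset j M))) =
    (\<Sum>(j, M)\<in>Sigma {1..n} (\<lambda>j. pmsets (n - j)). f (add_mset j M) / of_nat (mset_z M))"
    unfolding pavg_def by (subst sum.Sigma) auto
  also have "\<dots> = (\<Sum>(N, j)\<in>Sigma (pmsets n) set_mset. f N / of_nat (mset_z N) * of_nat (j * count N j))"
  proof (rule sum.reindex_bij_witness[where
        i = "\<lambda>(N, j). (j, N - {#j#})" and j = "\<lambda>(j, M). (add_mset j M, j)"], goal_cases)
    case (1 a)
    then show ?case by (auto simp: pmsets_def)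
  next
    case (2 a)
    then show ?case by (auto simp: pmsets_def)
  next
    case (3 b)
    then obtain N j where b: "b = (N, j)" "N \<in> pmsets n" "j \<in># N" by auto
    then obtain M where "N = add_mset j M" by (meson multi_member_split)
    with b show ?case
      by (auto simp: pmsets_def dest!: gr0I)
  next
    case (4 b)
    then obtain N j where b: "b = (N, j)" "N \<in> pmsets n" "j \<in># N" by auto
    then obtain M where "N = add_mset j M" by (meson multi_member_split)
    with b show ?case
      by (auto simp: pmsets_def)
  next
    case (5 a)
    then obtain j M where a: "a = (j, M)" "M \<in> pmsets (n - j)" "j \<ge> 1" by auto
    then have "mset_z M > 0" by (intro mset_z_pos) (auto simp: pmsets_def)
    then have nz: "of_nat (mset_z M) \<noteq> (0 :: 'a)" "of_nat (j * Suc (count M j)) \<noteq> (0 :: 'a)"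
      using a by (auto simp del: of_nat_Suc of_nat_mult mult_Suc_right)
    have "of_nat (mset_z (add_mset j M)) = (of_nat (mset_z M) * of_nat (j * Suc (count M j)) :: 'a)"
      by (simp only: mset_z_add_mset of_nat_mult mult_ac)
    then show ?case using a nz
      by (simp del: of_nat_Suc of_nat_mult mult_Suc_right)
  qed
  also have "\<dots> = (\<Sum>N\<in>pmsets n. \<Sum>j\<in>set_mset N. f N / of_nat (mset_z N) * of_nat (j * count N j))"
    by (subst sum.Sigma) auto
  also have "\<dots> = (\<Sum>N\<in>pmsets n. f N / of_nat (mset_z N) * of_nat n)"
    unfolding sum_distrib_left [symmetric] of_nat_sum [symmetric] sum_mset_conv_count [symmetric]
    by (rule sum.cong) (auto simp: pmsets_def)
  also have "\<dots> = of_nat n * pavg n f"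
    by (simp add: pavg_def sum_distrib_left mult_ac)
  finally show ?thesis ..
qed

lemma pavg_cong:
  "(\<And>M. 0 \<notin># M \<Longrightarrow> sum_mset M = n \<Longrightarrow> f M = g M) \<Longrightarrow> pavg n f = pavg n g"
  unfolding pavg_def by (rule sum.cong) (auto simp: pmsets_def)

lemma pavg_add: "pavg n (\<lambda>M. f M + g M) = pavg n f + pavg n g"
  by (simp add: pavg_def add_divide_distrib sum.distrib)

lemma pavg_zero [simp]: "pavg n (\<lambda>M. 0) = 0"
  by (simp add: pavg_def)

lemma pavg_diff: "pavg n (\<lambda>M. f M - g M) = pavg n f - pavg n g"
  by (simp add: pavg_def diff_divide_distrib sum_subtractf)

lemma pavg_sum: "pavg n (\<lambda>M. \<Sum>i\<in>I. f i M) = (\<Sum>i\<in>I. pavg n (f i))"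
  unfolding pavg_def by (subst sum.swap) (simp add: sum_divide_distrib)

lemma pavg_mult_left: "pavg n (\<lambda>M. c * f M) = c * pavg n f"
  by (simp add: pavg_def sum_distrib_left)

lemma pavg_mult_right: "pavg n (\<lambda>M. f M * c) = pavg n f * c"
  by (simp add: pavg_def sum_distrib_right)

lemma pavg_swap: "pavg n (\<lambda>M. pavg m (f M)) = pavg m (\<lambda>N. pavg n (\<lambda>M. f M N))"
  unfolding pavg_def sum_divide_distrib by (subst sum.swap) (simp add: mult_ac)

lemma pavg_msplit_swap: "pavg n (\<lambda>M. msplit (F M) N) = msplit (\<lambda>A B. pavg n (\<lambda>M. F M A B)) N"
proof -
  have "pavg n f = (\<Sum>M\<in>pmsets n. inverse (of_nat (mset_z M)) * f M)" for f :: "_ \<Rightarrow> 'a"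
    by (simp add: pavg_def divide_inverse mult.commute)
  then show ?thesis
    by (simp add: msplit_sum msplit_mult_left)
qed

text \<open>By Newton's identity and induction, \<open>n\<close> times the average is a sum of
  \<open>n\<close> ones.\<close>

lemma pavg_one [simp]: "pavg n (\<lambda>M. 1) = 1"
proof (induction n rule: less_induct)
  case (less n)
  show ?case
  proof (cases "n = 0")
    case False
    have "of_nat n * pavg n (\<lambda>M. 1 :: 'a) = (\<Sum>j\<in>{1..n}. 1)"
      unfolding pavg_Newton by (intro sum.cong less) auto
    with False show ?thesis by simp
  qed simp
qed

text \<open>This says that exponential generating functions multiply; it carries all identities between
  the operators below. The induction peels one part off by Newton's identity.\<close>

lemma pavg_msplit:
  "pavg n (msplit G) = (\<Sum>a\<le>n. pavg a (\<lambda>A. pavg (n - a) (\<lambda>B. G A B)))"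
proof (induction n arbitrary: G rule: less_induct)
  case (less n)
  show ?case
  proof (cases "n = 0")
    case False
    let ?E = "\<lambda>a b G. pavg a (\<lambda>A. pavg b (\<lambda>B. G A B))"
    let ?L = "\<lambda>j A B. G (add_mset j A) B" and ?R = "\<lambda>j A B. G A (add_mset j B)"
    have L: "of_nat a * ?E a b G = (\<Sum>j\<in>{1..a}. ?E (a - j) b (?L j))" for a b
      by (rule pavg_Newton)
    have R: "of_nat b * ?E a b G = (\<Sum>j\<in>{1..b}. ?E a (b - j) (?R j))" for a b
      unfolding pavg_mult_left [of a "of_nat b", symmetric] pavg_Newton pavg_sum ..
    have "of_nat n * pavg n (msplit G) =
        (\<Sum>j\<in>{1..n}. pavg (n - j) (msplit (?L j)) + pavg (n - j) (msplit (?R j)))"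
      by (simp add: pavg_Newton msplit_add_mset pavg_add)
    also have "\<dots> = (\<Sum>j\<in>{1..n}. (\<Sum>a\<le>n - j. ?E a (n - j - a) (?L j)) +
        (\<Sum>a\<le>n - j. ?E a (n - j - a) (?R j)))"
      by (intro sum.cong refl arg_cong2[where f = "(+)"] less) auto
    also have "\<dots> = (\<Sum>j\<in>{1..n}. \<Sum>a\<le>n - j. ?E a (n - j - a) (?L j)) +
        (\<Sum>j\<in>{1..n}. \<Sum>a\<le>n - j. ?E a (n - j - a) (?R j))"
      by (simp add: sum.distrib)
    also have "(\<Sum>j\<in>{1..n}. \<Sum>a\<le>n - j. ?E a (n - j - a) (?L j)) =
        (\<Sum>a\<le>n. \<Sum>j\<in>{1..a}. ?E (a - j) (n - a) (?L j))"
      unfolding sum.Sigma[OF finite_atLeastAtMost ballI[OF finite_atMost]]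
        sum.Sigma[OF finite_atMost ballI[OF finite_atLeastAtMost]]
      by (rule sum.reindex_bij_witness[where i = "\<lambda>(a, j). (j, a - j)" and j = "\<lambda>(j, a). (j + a, j)"])
        auto
    also have "(\<Sum>j\<in>{1..n}. \<Sum>a\<le>n - j. ?E a (n - j - a) (?R j)) =
        (\<Sum>a\<le>n. \<Sum>j\<in>{1..n - a}. ?E a (n - a - j) (?R j))"
      unfolding sum.Sigma[OF finite_atLeastAtMost ballI[OF finite_atMost]]
        sum.Sigma[OF finite_atMost ballI[OF finite_atLeastAtMost]]
      by (rule sum.reindex_bij_witness[where i = "\<lambda>(a, j). (j, a)" and j = "\<lambda>(j, a). (a, j)"])
        (auto simp: add.commute)
    \<comment> \<open>Newton's identity is now read backwards on either side of the splitting; the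
      resulting weights \<open>a\<close> and \<open>n - a\<close> add up to \<open>n\<close>, which
      cancels at the end.\<close>
    also have "(\<Sum>a\<le>n. \<Sum>j\<in>{1..a}. ?E (a - j) (n - a) (?L j)) +
        (\<Sum>a\<le>n. \<Sum>j\<in>{1..n - a}. ?E a (n - a - j) (?R j)) =
        (\<Sum>a\<le>n. of_nat a * ?E a (n - a) G + of_nat (n - a) * ?E a (n - a) G)"
      by (simp only: L R sum.distrib)
    also have "\<dots> = (\<Sum>a\<le>n. of_nat n * ?E a (n - a) G)"
      by (rule sum.cong) (auto simp flip: distrib_right of_nat_add)
    also have "\<dots> = of_nat n * (\<Sum>a\<le>n. ?E a (n - a) G)"
      by (simp add: sum_distrib_left)
    finally show ?thesis
      using False by simp
  qed simp
qed


section \<open>Bernstein operators\<close>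

text \<open>A function \<open>f\<close> of cycle types stands for the symmetric function whose scalar product
  with \<open>p\<^sub>M\<close> is \<open>f M\<close>. Then \<open>skew 1 n\<close> is the adjoint of multiplication by \<open>h\<^sub>n\<close>,
  and \<open>skew (-1) n\<close> is the adjoint of multiplication by \<open>(-1)\<^sup>n e\<^sub>n\<close>, which is \<open>emult n\<close>.\<close>

definition skew ::
  "'a \<Rightarrow> nat \<Rightarrow> (nat multiset \<Rightarrow> 'a::field_char_0) \<Rightarrow> nat multiset \<Rightarrow> 'a" where
  "skew t n f M = pavg n (\<lambda>A. t ^ size A * f (M + A))"

text \<open>Since \<open>h\<^sub>k\<close> has scalar product 1 with every power sum product of
  degree \<open>k\<close>, multiplication by it selects the splittings with
  \<open>sum_mset A = k\<close>. The sum over \<open>i\<close> in Bernstein's operator is thus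
  absorbed into one splitting, with \<open>i = sum_mset A - m\<close>.\<close>

definition bernstein ::
  "nat \<Rightarrow> (nat multiset \<Rightarrow> 'a::field_char_0) \<Rightarrow> nat multiset \<Rightarrow> 'a" where
  "bernstein m f =
     msplit (\<lambda>A B. if m \<le> sum_mset A then skew (-1) (sum_mset A - m) f B else 0)"

definition emult ::
  "nat \<Rightarrow> (nat multiset \<Rightarrow> 'a::field_char_0) \<Rightarrow> nat multiset \<Rightarrow> 'a" where
  "emult i f = msplit (\<lambda>A B. if sum_mset A = i then (-1) ^ size A * f B else 0)"

primrec frobenius :: "nat list \<Rightarrow> nat multiset \<Rightarrow> 'a::field_char_0" where
  "frobenius [] = (\<lambda>M. if M = {#} then 1 else 0)"
| "frobenius (m # lam) = bernstein m (frobenius lam)"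

text \<open>The scalar product with \<open>h\<^sub>\<alpha>\<close>, that is, the average of \<open>f\<close> over a Young subgroup.\<close>

primrec hpair :: "nat list \<Rightarrow> (nat multiset \<Rightarrow> 'a::field_char_0) \<Rightarrow> 'a" where
  "hpair [] f = f {#}"
| "hpair (m # al) f = hpair al (skew 1 m f)"

text \<open>Lists with zeros and of any length are compared, because \<open>pavg_frobenius\<close>
  meets lists \<open>(m + i) # be\<close> of which only the first entry and the sum are
  known.\<close>

primrec lexgt :: "nat list \<Rightarrow> nat list \<Rightarrow> bool" where
  "lexgt [] l \<longleftrightarrow> False"
| "lexgt (a # al) l \<longleftrightarrow> (case l of [] \<Rightarrow> False | b # be \<Rightarrow> a > b \<or> a = b \<and> lexgt al be)"

section \<open>Relations between the skewing operators\<close>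

lemma skew_cong:
  "0 \<notin># M \<Longrightarrow> (\<And>N. 0 \<notin># N \<Longrightarrow> f N = g N) \<Longrightarrow> skew t n f M = skew t n g M"
  unfolding skew_def by (intro pavg_cong) auto

lemma skew_zero [simp]: "skew t n (\<lambda>M. 0) = (\<lambda>M. 0)"
  by (simp add: skew_def fun_eq_iff)

lemma skew_diff: "skew t n (\<lambda>M. f M - g M) = (\<lambda>M. skew t n f M - skew t n g M)"
  by (simp add: skew_def fun_eq_iff pavg_diff right_diff_distrib)

lemma skew_commute: "skew s a (skew t b f) M = skew t b (skew s a f) M"
  unfolding skew_def pavg_mult_left [symmetric]
  by (subst pavg_swap) (simp add: mult_ac add_ac)

text \<open>A multiset of positive weight is nonempty, so its power of 0 vanishes.\<close>

lemma skew_0_left: "skew 0 n f M = (if n = 0 then f M else 0)"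
proof (cases "n = 0")
  case False
  have "skew 0 n f M = pavg n (\<lambda>A. 0)"
    unfolding skew_def using False by (intro pavg_cong) (auto simp: power_0_left)
  with False show ?thesis by simp
qed (simp add: skew_def)

text \<open>The operators \<open>skew t n\<close> are adjoint to the coefficients of
  \<open>exp (t * \<Sum>\<^sub>k p\<^sub>k z^k / k)\<close>, and exponentials multiply by adding
  \<open>s\<close> and \<open>t\<close>. For \<open>s = 1\<close> and \<open>t = -1\<close> this is
  the relation between the complete and the elementary symmetric functions.\<close>

lemma sum_skew_skew: "(\<Sum>b\<le>n. skew s (n - b) (skew t b f) M) = skew (s + t) n f M"
proof -
  have "skew (s + t) n f M =
      pavg n (msplit (\<lambda>A B. t ^ size A * (s ^ size B * f (M + B + A))))"
    unfolding skew_def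
  proof (rule arg_cong[where f = "pavg n"], rule ext)
    fix C
    have "(s + t) ^ size C * f (M + C) = msplit (\<lambda>A B. f (M + C) * (t ^ size A * s ^ size B)) C"
      by (simp add: msplit_mult_left msplit_power_size add.commute)
    also have "\<dots> = msplit (\<lambda>A B. t ^ size A * (s ^ size B * f (M + B + A))) C"
      by (rule msplit_cong) (auto simp: add_ac mult_ac)
    finally show "(s + t) ^ size C * f (M + C) = \<dots>" .
  qed
  also have "\<dots> = (\<Sum>b\<le>n. skew t b (skew s (n - b) f) M)"
    unfolding pavg_msplit by (simp add: skew_def pavg_mult_left add_ac)
  also have "\<dots> = (\<Sum>b\<le>n. skew s (n - b) (skew t b f) M)"
    by (simp add: skew_commute)
  finally show ?thesis ..
qed

lemma pavg_const [simp]: "pavg n (\<lambda>M. c) = c"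
  using pavg_mult_left[of n c "\<lambda>M. 1"] by simp

lemma skew_one_msplit:
  "skew 1 r (msplit K) M =
     msplit (\<lambda>A B. \<Sum>a\<le>r. pavg a (\<lambda>C. pavg (r - a) (\<lambda>D. K (A + C) (B + D)))) M"
  by (simp add: skew_def msplit_union pavg_msplit_swap pavg_msplit)

text \<open>Here \<open>d\<close> plays the role of the largest part of the partition \<open>\<lambda>\<setminus>\<lambda>\<^sub>1\<close>. After commuting
  the operators, the sum becomes \<open>\<Sum>\<^sub>b skew (-1) (s - b) \<circ> skew 1 b = skew 0 s\<close>.\<close>

lemma skew_bernstein:
  assumes M: "0 \<notin># M" and f: "\<And>b N. d < b \<Longrightarrow> 0 \<notin># N \<Longrightarrow> skew 1 b f N = 0"
    and "d \<le> m" "m \<le> r"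
  shows "skew 1 r (bernstein m f) M = (if r = m then f M else 0)"
proof -
  have "(\<Sum>a\<le>r. pavg a (\<lambda>C. pavg (r - a) (\<lambda>D. if m \<le> sum_mset (A + C)
            then skew (-1) (sum_mset (A + C) - m) f (B + D) else 0))) =
        (if A = {#} then if r = m then f B else 0 else 0)" if AB: "A + B = M" for A B
  proof -
    \<comment> \<open>No truncation occurs, as \<open>m \<le> r\<close>. The substitution
      \<open>b = r - a\<close> below makes the degrees of the two skewing operators add up to
      \<open>?s\<close>.\<close>
    let ?s = "sum_mset A + r - m"
    have B: "0 \<notin># B" using M AB by auto
    have "(\<Sum>a\<le>r. pavg a (\<lambda>C. pavg (r - a) (\<lambda>D. if m \<le> sum_mset (A + C)
            then skew (-1) (sum_mset (A + C) - m) f (B + D) else 0))) =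
        (\<Sum>a\<le>r. pavg a (\<lambda>C. pavg (r - a) (\<lambda>D. if m \<le> sum_mset A + a
            then skew (-1) (sum_mset A + a - m) f (B + D) else 0)))"
      by (intro sum.cong pavg_cong) auto
    also have "\<dots> = (\<Sum>a\<le>r. if m \<le> sum_mset A + a
            then skew 1 (r - a) (skew (-1) (sum_mset A + a - m) f) B else 0)"
      by (rule sum.cong) (auto simp: skew_def)
    also have "\<dots> = (\<Sum>a\<in>{a\<in>{..r}. m \<le> sum_mset A + a}.
            skew (-1) (sum_mset A + a - m) (skew 1 (r - a) f) B)"
      by (subst sum.inter_filter) (simp_all add: skew_commute[of 1 _ "-1"] cong: if_cong)
    also have "\<dots> = (\<Sum>b\<in>{b\<in>{..r}. b \<le> ?s}. skew (-1) (?s - b) (skew 1 b f) B)"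
      by (rule sum.reindex_bij_witness[where i = "\<lambda>b. r - b" and j = "\<lambda>a. r - a"])
        (use \<open>m \<le> r\<close> in \<open>auto intro!: arg_cong2[where f = "\<lambda>x. skew (-1) x"] simp: algebra_simps\<close>)
    \<comment> \<open>The added terms have \<open>b > r\<close>, hence \<open>b > d\<close>, and
      vanish by the assumption on \<open>f\<close>. Only the completed sum can be evaluated by
      \<open>sum_skew_skew\<close>.\<close>
    also have "\<dots> = (\<Sum>b\<le>?s. skew (-1) (?s - b) (skew 1 b f) B)"
    proof (rule sum.mono_neutral_left)
      show "\<forall>b\<in>{..?s} - {b\<in>{..r}. b \<le> ?s}. skew (-1) (?s - b) (skew 1 b f) B = 0"
      proof
        fix b assume "b \<in> {..?s} - {b\<in>{..r}. b \<le> ?s}"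
        then have "d < b" using assms by auto
        then have "skew (-1) (?s - b) (skew 1 b f) B = skew (-1) (?s - b) (\<lambda>M. 0) B"
          by (intro skew_cong B f)
        then show "skew (-1) (?s - b) (skew 1 b f) B = 0" by simp
      qed
    qed auto
    also have "\<dots> = (if ?s = 0 then f B else 0)"
      unfolding sum_skew_skew by (simp only: add.left_inverse skew_0_left)
    also have "?s = 0 \<longleftrightarrow> A = {#} \<and> r = m"
    proof -
      have "0 \<notin># A" using M AB by auto
      then have "sum_mset A = 0 \<longleftrightarrow> A = {#}"
        by (auto) (metis multiset_nonemptyE)
      moreover have "?s = 0 \<longleftrightarrow> sum_mset A = 0 \<and> r = m"
        using \<open>m \<le> r\<close> by linarith
      ultimately show ?thesis by simp
    qed
    finally show ?thesis by auto
  qed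
  then have "skew 1 r (bernstein m f) M = msplit (\<lambda>A B. if A = {#} then if r = m then f B else 0 else 0) M"
    unfolding bernstein_def skew_one_msplit by (intro msplit_cong) auto
  then show ?thesis
    by (simp add: msplit_only_empty_left)
qed

text \<open>The vanishing for the tail of \<open>lam\<close> is the hypothesis of
  \<open>skew_bernstein\<close> for \<open>lam\<close> itself, with \<open>d\<close> the first part
  of the tail. The default 0 for the empty list reflects that \<open>skew 1 b\<close> with
  \<open>b > 0\<close> kills the symmetric function 1.\<close>

lemma skew_frobenius:
  assumes "sorted_wrt (\<ge>) lam" "0 \<notin># M"
  shows "(case lam of [] \<Rightarrow> 0 | m # _ \<Rightarrow> m) < b \<Longrightarrow> skew 1 b (frobenius lam) M = (0 :: 'a::field_char_0)"
    and "lam = m # l \<Longrightarrow> skew 1 m (frobenius lam) M = (frobenius l M :: 'a)"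
proof -
  have "((case lam of [] \<Rightarrow> 0 | m # _ \<Rightarrow> m) < b \<longrightarrow> skew 1 b (frobenius lam) M = (0 :: 'a)) \<and>
    (\<forall>m l. lam = m # l \<longrightarrow> skew 1 m (frobenius lam) M = (frobenius l M :: 'a))"
    using assms
  proof (induction lam arbitrary: b M)
    case Nil
    have "skew 1 b (frobenius []) M = pavg b (\<lambda>A. 0)" if "b > 0"
      unfolding skew_def using that by (intro pavg_cong) auto
    then show ?case by auto
  next
    case (Cons k l)
    let ?d = "case l of [] \<Rightarrow> 0 | m # _ \<Rightarrow> m"
    have "?d \<le> k" using Cons.prems by (auto split: list.splits)
    moreover have "skew 1 b (frobenius l) N = (0 :: 'a)" if "?d < b" "0 \<notin># N" for b N
      using Cons.IH[of N b] Cons.prems that by auto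
    ultimately have "skew 1 r (frobenius (k # l)) M = (if r = k then frobenius l M else (0 :: 'a))"
      if "k \<le> r" for r
      unfolding frobenius.simps using Cons.prems that by (intro skew_bernstein[where d = ?d])
    then show ?case by auto
  qed
  then show "(case lam of [] \<Rightarrow> 0 | m # _ \<Rightarrow> m) < b \<Longrightarrow> skew 1 b (frobenius lam) M = (0 :: 'a::field_char_0)"
    and "lam = m # l \<Longrightarrow> skew 1 m (frobenius lam) M = (frobenius l M :: 'a)"
    by auto
qed

section \<open>Scalar products with products of complete homogeneous functions\<close>

lemma hpair_cong:
  "(\<And>M. 0 \<notin># M \<Longrightarrow> f M = g M) \<Longrightarrow> hpair al f = hpair al g"
proof (induction al arbitrary: f g)
  case (Cons a al)
  show ?case
    unfolding hpair.simps by (intro Cons.IH skew_cong Cons.prems)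
qed simp

lemma hpair_zero [simp]: "hpair al (\<lambda>M. 0) = 0"
  by (induction al) simp_all

lemma hpair_diff: "hpair al (\<lambda>M. f M - g M) = hpair al f - hpair al g"
  by (induction al arbitrary: f g) (simp_all add: skew_diff)

text \<open>Each part of the pairing list strips the equal first row of the partition, down to the
  empty one.\<close>

lemma hpair_frobenius_self:
  "sorted_wrt (\<ge>) lam \<Longrightarrow> hpair lam (frobenius lam) = 1"
proof (induction lam)
  case (Cons m lam)
  have "hpair (m # lam) (frobenius (m # lam)) = (hpair lam (frobenius lam) :: 'a)"
    unfolding hpair.simps(2) using Cons.prems by (intro hpair_cong skew_frobenius(2)) auto
  then show ?case using Cons by simp
qed simp

text \<open>Equal leading parts strip rows; at the first difference the part of \<open>al\<close>
  exceeds the current first row and kills the function.\<close>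

lemma hpair_frobenius_lexgt:
  "sorted_wrt (\<ge>) lam \<Longrightarrow> lexgt al lam \<Longrightarrow> hpair al (frobenius lam) = 0"
proof (induction lam arbitrary: al)
  case Nil
  then show ?case by (cases al) auto
next
  case (Cons m lam)
  then obtain r be where al: "al = r # be" by (cases al) auto
  consider "r > m" | "r = m" "lexgt be lam" using Cons.prems by (auto simp: al)
  then show ?case
  proof cases
    case 1
    then have "hpair al (frobenius (m # lam)) = hpair be (\<lambda>M. 0 :: 'a)"
      unfolding al hpair.simps(2) using Cons.prems by (intro hpair_cong skew_frobenius(1)) auto
    then show ?thesis by simp
  next
    case 2
    then have "hpair al (frobenius (m # lam)) = (hpair be (frobenius lam) :: 'a)"
      unfolding al hpair.simps(2) using Cons.prems by (intro hpair_cong skew_frobenius(2)) auto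
    then show ?thesis using Cons 2 by simp
  qed
qed

text \<open>For the constant function 1, \<open>sum_skew_skew\<close> says that the partial sums of
  these averages are 1 at \<open>n = 0\<close> and 0 afterwards. The averages are the differences of
  the partial sums.\<close>

lemma pavg_sign: "pavg n (\<lambda>C. (-1) ^ size C) = (if n = 0 then 1 else if n = 1 then -1 else 0)"
proof -
  let ?e = "\<lambda>n. pavg n (\<lambda>C. (-1) ^ size C :: 'a)"
  have e: "(\<Sum>b\<le>n. ?e b) = (if n = 0 then 1 else 0)" for n
    using sum_skew_skew[of 1 n "-1" "\<lambda>M. 1 :: 'a" "{#}"] by (simp add: skew_0_left) (simp add: skew_def)
  show ?thesis
    using e[of n] e[of "n - 1"] by (cases n) (auto split: if_splits simp: eq_neg_iff_add_eq_0 add.commute)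
qed

lemma skew_emult:
  "skew 1 r (emult i g) M = emult i (skew 1 r g) M -
     (if r > 0 \<and> i > 0 then emult (i - 1) (skew 1 (r - 1) g) M else 0)"
proof -
  let ?t = "\<lambda>a A B. if sum_mset A + a = i then (-1) ^ size A * ((if a = 0 then 1 else if a = 1 then -1 else 0) *
      skew 1 (r - a) g B) else 0"
  have "(\<Sum>a\<le>r. pavg a (\<lambda>C. pavg (r - a) (\<lambda>D. if sum_mset (A + C) = i
            then (-1) ^ size (A + C) * g (B + D) else 0))) =
        (if sum_mset A = i then (-1) ^ size A * skew 1 r g B else 0) -
        (if r > 0 \<and> sum_mset A + 1 = i then (-1) ^ size A * skew 1 (r - 1) g B else 0)" for A B
  proof -
    have "(\<Sum>a\<le>r. pavg a (\<lambda>C. pavg (r - a) (\<lambda>D. if sum_mset (A + C) = i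
            then (-1) ^ size (A + C) * g (B + D) else 0))) =
          (\<Sum>a\<le>r. pavg a (\<lambda>C. pavg (r - a) (\<lambda>D. if sum_mset A + a = i
            then (-1) ^ size A * ((-1) ^ size C * g (B + D)) else 0)))"
      by (intro sum.cong pavg_cong) (auto simp: power_add)
    also have "\<dots> = (\<Sum>a\<le>r. ?t a A B)"
      by (rule sum.cong) (auto simp: pavg_mult_left pavg_mult_right pavg_sign skew_def)
    also have "\<dots> = (\<Sum>a\<in>{..r} \<inter> {0, 1}. ?t a A B)"
      by (rule sum.mono_neutral_right) auto
    also have "{..r} \<inter> {0, 1} = (if r = 0 then {0} else {0, 1})"
      by auto
    also have "sum (\<lambda>a. ?t a A B) \<dots> = (if sum_mset A = i then (-1) ^ size A * skew 1 r g B else 0) -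
        (if r > 0 \<and> sum_mset A + 1 = i then (-1) ^ size A * skew 1 (r - 1) g B else 0)"
      by auto
    finally show ?thesis .
  qed
  then have "skew 1 r (emult i g) M =
     msplit (\<lambda>A B. (if sum_mset A = i then (-1) ^ size A * skew 1 r g B else 0) +
        - (if r > 0 \<and> sum_mset A + 1 = i then (-1) ^ size A * skew 1 (r - 1) g B else 0)) M"
    unfolding emult_def skew_one_msplit by (intro msplit_cong) simp
  also have "\<dots> = emult i (skew 1 r g) M -
     msplit (\<lambda>A B. if r > 0 \<and> sum_mset A + 1 = i then (-1) ^ size A * skew 1 (r - 1) g B else 0) M"
    unfolding msplit_add msplit_minus emult_def by simp
  also have "msplit (\<lambda>A B. if r > 0 \<and> sum_mset A + 1 = i then (-1) ^ size A * skew 1 (r - 1) g B else 0) M =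
     (if r > 0 \<and> i > 0 then emult (i - 1) (skew 1 (r - 1) g) M else 0)"
  proof (cases "r > 0 \<and> i > 0")
    case True
    then show ?thesis
      unfolding emult_def by (auto intro!: msplit_cong)
  next
    case False
    then have "msplit (\<lambda>A B. if r > 0 \<and> sum_mset A + 1 = i then (-1) ^ size A * skew 1 (r - 1) g B else 0) M =
       msplit (\<lambda>A B. 0) M"
      by (intro msplit_cong) auto
    with False show ?thesis by auto
  qed
  finally show ?thesis .
qed

text \<open>Iterating \<open>skew_emult\<close> expands the left-hand side into signed pairings of
  \<open>g\<close> with lists that arise from \<open>al\<close> by lowering \<open>i\<close> of its
  parts by 1.\<close>

lemma hpair_emult:
  "(\<And>be. sum_list be + i = sum_list al \<Longrightarrow> hpair be g = 0) \<Longrightarrow> hpair al (emult i g) = 0"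
proof (induction al arbitrary: i g)
  case Nil
  then show ?case using Nil.prems[of "[]"] by (auto simp: emult_def)
next
  case (Cons r al)
  have 1: "hpair al (emult i (skew 1 r g)) = 0"
    using Cons.prems[of "r # _"] by (intro Cons.IH) auto
  show ?case
  proof (cases "r > 0 \<and> i > 0")
    case True
    have 2: "hpair al (emult (i - 1) (skew 1 (r - 1) g)) = 0"
      using Cons.prems[of "(r - 1) # _"] True by (intro Cons.IH) auto
    have "skew 1 r (emult i g) = (\<lambda>M. emult i (skew 1 r g) M - emult (i - 1) (skew 1 (r - 1) g) M)"
      using True by (simp add: fun_eq_iff skew_emult)
    then show ?thesis using 1 2 by (simp add: hpair_diff)
  next
    case False
    then have "skew 1 r (emult i g) = emult i (skew 1 r g)"
      by (auto simp add: fun_eq_iff skew_emult)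
    then show ?thesis using 1 by simp
  qed
qed

text \<open>Adjointness of \<open>emult i\<close> and \<open>skew (-1) i\<close>: after
  \<open>pavg_msplit\<close> only the splittings whose first side has weight \<open>i\<close>
  survive.\<close>

lemma pavg_emult:
  assumes "i \<le> n"
  shows "pavg n (\<lambda>M. emult i g M * u M) = pavg (n - i) (\<lambda>B. g B * skew (-1) i u B)"
proof -
  have "emult i g M * u M = msplit (\<lambda>A B. if sum_mset A = i then (-1) ^ size A * g B * u (A + B) else 0) M" for M
    unfolding emult_def mult.commute[of _ "u M"] msplit_mult_left [symmetric]
    by (rule msplit_cong) (auto simp: mult_ac)
  then have "pavg n (\<lambda>M. emult i g M * u M) = (\<Sum>a\<le>n. pavg a (\<lambda>A. pavg (n - a)
      (\<lambda>B. if sum_mset A = i then (-1) ^ size A * g B * u (A + B) else 0)))"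
    by (simp add: pavg_msplit)
  also have "\<dots> = (\<Sum>a\<le>n. if a = i then pavg a (\<lambda>A. pavg (n - a)
      (\<lambda>B. (-1) ^ size A * g B * u (A + B))) else 0)"
  proof (rule sum.cong)
    fix a
    have "pavg a (\<lambda>A. pavg (n - a) (\<lambda>B. if sum_mset A = i then (-1) ^ size A * g B * u (A + B) else 0)) =
      pavg a (\<lambda>A. pavg (n - a) (\<lambda>B. if a = i then (-1) ^ size A * g B * u (A + B) else 0))"
      by (intro pavg_cong) auto
    then show "pavg a (\<lambda>A. pavg (n - a) (\<lambda>B. if sum_mset A = i then (-1) ^ size A * g B * u (A + B) else 0)) =
      (if a = i then pavg a (\<lambda>A. pavg (n - a) (\<lambda>B. (-1) ^ size A * g B * u (A + B))) else 0)"
      by auto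
  qed simp
  also have "\<dots> = pavg i (\<lambda>A. pavg (n - i) (\<lambda>B. (-1) ^ size A * g B * u (A + B)))"
    using assms by simp
  also have "\<dots> = pavg (n - i) (\<lambda>B. g B * skew (-1) i u B)"
    unfolding skew_def pavg_mult_left [symmetric] by (subst pavg_swap) (simp add: mult_ac add_ac)
  finally show ?thesis .
qed

lemma pavg_bernstein:
  assumes "m \<le> n"
  shows "pavg n (\<lambda>M. f M * bernstein m u M) =
    (\<Sum>i\<le>n - m. pavg (n - m) (\<lambda>M. emult i (skew 1 (m + i) f) M * u M))"
proof -
  have "f M * bernstein m u M =
     msplit (\<lambda>A B. if m \<le> sum_mset A then f (A + B) * skew (-1) (sum_mset A - m) u B else 0) M" for M
    unfolding bernstein_def msplit_mult_left [symmetric] by (rule msplit_cong) auto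
  then have "pavg n (\<lambda>M. f M * bernstein m u M) = (\<Sum>a\<le>n. pavg a (\<lambda>A. pavg (n - a)
      (\<lambda>B. if m \<le> sum_mset A then f (A + B) * skew (-1) (sum_mset A - m) u B else 0)))"
    by (simp add: pavg_msplit)
  also have "\<dots> = (\<Sum>a\<le>n. if m \<le> a then pavg (n - a) (\<lambda>B. skew 1 a f B * skew (-1) (a - m) u B) else 0)"
  proof (rule sum.cong)
    fix a
    have "pavg a (\<lambda>A. pavg (n - a)
          (\<lambda>B. if m \<le> sum_mset A then f (A + B) * skew (-1) (sum_mset A - m) u B else 0)) =
        pavg a (\<lambda>A. pavg (n - a) (\<lambda>B. if m \<le> a then f (A + B) * skew (-1) (a - m) u B else 0))"
      by (intro pavg_cong) auto
    also have "\<dots> = (if m \<le> a then pavg (n - a) (\<lambda>B. skew 1 a f B * skew (-1) (a - m) u B) else 0)"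
      by (subst pavg_swap) (auto simp: skew_def[of 1] pavg_mult_right add.commute)
    finally show "pavg a (\<lambda>A. pavg (n - a)
        (\<lambda>B. if m \<le> sum_mset A then f (A + B) * skew (-1) (sum_mset A - m) u B else 0)) = \<dots>" .
  qed simp
  also have "\<dots> = (\<Sum>a\<in>{m..n}. pavg (n - a) (\<lambda>B. skew 1 a f B * skew (-1) (a - m) u B))"
    by (rule sum.mono_neutral_cong_right) auto
  also have "\<dots> = (\<Sum>i\<le>n - m. pavg (n - m - i) (\<lambda>B. skew 1 (m + i) f B * skew (-1) i u B))"
    by (rule sum.reindex_bij_witness[where i = "\<lambda>i. m + i" and j = "\<lambda>a. a - m"])
      (use assms in auto)
  also have "\<dots> = (\<Sum>i\<le>n - m. pavg (n - m) (\<lambda>M. emult i (skew 1 (m + i) f) M * u M))"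
    by (rule sum.cong) (auto simp: pavg_emult)
  finally show ?thesis .
qed

lemma emult_0:
  assumes "0 \<notin># M"
  shows "emult 0 g M = g M"
proof -
  have "emult 0 g M = msplit (\<lambda>A B. if A = {#} then g B else 0) M"
    unfolding emult_def
  proof (rule msplit_cong)
    fix A B assume "A + B = M"
    then have "0 \<notin># A" using assms by auto
    then have "sum_mset A = 0 \<longleftrightarrow> A = {#}"
      by (auto) (metis multiset_nonemptyE)
    then show "(if sum_mset A = 0 then (-1) ^ size A * g B else 0) = (if A = {#} then g B else 0)"
      by auto
  qed
  then show ?thesis by (simp add: msplit_only_empty_left)
qed

text \<open>In other words, the symmetric function \<open>frobenius \<lambda>\<close> is \<open>h\<^sub>\<lambda>\<close> plus a linear
  combination of \<open>h\<^sub>\<alpha>\<close> with \<open>\<alpha>\<close> lexicographically larger than \<open>\<lambda>\<close>.\<close>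

lemma pavg_frobenius:
  assumes "sum_list lam = n" "\<And>al. sum_list al = n \<Longrightarrow> lexgt al lam \<Longrightarrow> hpair al f = 0"
  shows "pavg n (\<lambda>M. f M * frobenius lam M) = hpair lam f"
  using assms
proof (induction lam arbitrary: n f)
  case (Cons m lam)
  define N where "N = n - m"
  have N: "sum_list lam = N" "n = m + N" using Cons.prems by (auto simp: N_def)
  let ?g = "\<lambda>i. emult i (skew 1 (m + i) f)"
  have 0: "hpair al (?g 0) = hpair (m # al) f" for al
    by (auto intro: hpair_cong emult_0)
  \<comment> \<open>By \<open>hpair_emult\<close> this involves \<open>f\<close> only through lists
    starting with \<open>m + i\<close>, which are lexicographically larger than
    \<open>m # lam\<close>. So only \<open>i = 0\<close> contributes in the end.\<close>
  have i: "hpair al (?g i) = 0" if "sum_list al = N" "i > 0" for i al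
  proof (rule hpair_emult)
    fix be assume "sum_list be + i = sum_list al"
    then show "hpair be (skew 1 (m + i) f) = 0"
      using Cons.prems(2)[of "(m + i) # be"] that N by auto
  qed
  have "pavg n (\<lambda>M. f M * frobenius (m # lam) M) = (\<Sum>i\<le>N. pavg N (\<lambda>M. ?g i M * frobenius lam M))"
    using N by (simp add: pavg_bernstein)
  also have "\<dots> = (\<Sum>i\<le>N. hpair lam (?g i))"
  proof (intro sum.cong Cons.IH refl)
    fix i al assume "sum_list al = N" "lexgt al lam"
    then show "hpair al (?g i) = 0"
      using i[of al i] 0[of al] Cons.prems(2)[of "m # al"] N by (cases "i = 0") auto
  qed (use N in auto)
  also have "\<dots> = (\<Sum>i\<in>{0}. hpair lam (?g i))"
    by (rule sum.mono_neutral_right) (use i N in auto)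
  finally show ?case using 0 by simp
qed simp


section \<open>Cycle types\<close>

text \<open>The ground set is arbitrary so that points can be inserted one at a time and the blocks
  of a Young subgroup can be treated separately.\<close>

definition ctype :: "'a set \<Rightarrow> ('a \<Rightarrow> 'a) \<Rightarrow> nat multiset" where
  "ctype X p = image_mset card (mset_set (orbit p ` X))"

lemma cycle_type_conv_ctype: "cycle_type n = ctype {1..n}"
  by (simp add: fun_eq_iff cycle_type_def ctype_def)

text \<open>The right-hand side describes a new point that either becomes a fixed point or enters a
  cycle of length \<open>j\<close> in one of \<open>j\<close> places. The identity itself follows
  from Newton's identity alone and later drives the count of permutations.\<close>

lemma pavg_Suc_insert:
  "of_nat (Suc n) * pavg (Suc n) f =
     pavg n (\<lambda>M. f (add_mset 1 M) + (\<Sum>j\<in>#M. of_nat j * f (add_mset (Suc j) (M - {#j#}))))"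
proof (induction n arbitrary: f rule: less_induct)
  case (less n)
  let ?D = "\<lambda>f M. f (add_mset 1 M) + (\<Sum>j\<in>#M. of_nat j * f (add_mset (Suc j) (M - {#j#}))) :: 'a"
  let ?f = "\<lambda>i M. f (add_mset i M)"
  \<comment> \<open>The insertion either leaves the distinguished part \<open>i\<close> alone or
    lengthens it, in \<open>i\<close> ways.\<close>
  have D: "?D f (add_mset i M) = ?D (?f i) M + of_nat i * ?f (Suc i) M" for i M
  proof -
    have "(\<Sum>j\<in>#M. of_nat j * f (add_mset (Suc j) (add_mset i M - {#j#}))) =
      (\<Sum>j\<in>#M. of_nat j * ?f i (add_mset (Suc j) (M - {#j#})))"
    proof (intro arg_cong[where f = sum_mset] image_mset_cong)
      fix j assume "j \<in># M"
      then have "add_mset i M - {#j#} = add_mset i (M - {#j#})"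
        by (metis add_mset_commute add_mset_remove_trivial multi_member_split)
      then show "of_nat j * f (add_mset (Suc j) (add_mset i M - {#j#})) =
          of_nat j * ?f i (add_mset (Suc j) (M - {#j#}))"
        by (simp add: add_mset_commute)
    qed
    then show ?thesis by (simp add: add_mset_commute add_ac)
  qed
  show ?case
  proof (cases "n = 0")
    case True
    then show ?thesis using pavg_Newton[of 1 f] by simp
  next
    case False
    have N: "pavg (n - i) (?D (?f i)) = of_nat (Suc n - i) * pavg (Suc n - i) (?f i)" if "i \<in> {1..n}" for i
      using less[of "n - i" "?f i"] that by (simp add: Suc_diff_le)
    have "of_nat n * pavg n (?D f) = (\<Sum>i\<in>{1..n}. pavg (n - i) (\<lambda>M. ?D (?f i) M + of_nat i * ?f (Suc i) M))"
      unfolding pavg_Newton by (simp only: D)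
    also have "\<dots> = (\<Sum>i\<in>{1..n}. of_nat (Suc n - i) * pavg (Suc n - i) (?f i) +
        of_nat i * pavg (n - i) (?f (Suc i)))"
    proof (rule sum.cong)
      fix i assume i: "i \<in> {1..n}"
      show "pavg (n - i) (\<lambda>M. ?D (?f i) M + of_nat i * ?f (Suc i) M) =
          of_nat (Suc n - i) * pavg (Suc n - i) (?f i) + of_nat i * pavg (n - i) (?f (Suc i))"
        unfolding pavg_add[of "n - i" "?D (?f i)"] pavg_mult_left N[OF i] ..
    qed simp
    also have "\<dots> = (\<Sum>i\<in>{1..n}. of_nat (Suc n - i) * pavg (Suc n - i) (?f i)) +
        (\<Sum>i\<in>{1..n}. of_nat i * pavg (n - i) (?f (Suc i)))"
      by (rule sum.distrib)
    \<comment> \<open>The added term \<open>i = Suc n\<close> has weight 0, and so has the term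
      \<open>i = 1\<close> added to the second sum below. On the common range the weights
      \<open>Suc n - i\<close> and \<open>i - 1\<close> add up to \<open>n\<close>.\<close>
    also have "(\<Sum>i\<in>{1..n}. of_nat (Suc n - i) * pavg (Suc n - i) (?f i)) =
        (\<Sum>i\<in>{1..Suc n}. of_nat (Suc n - i) * pavg (Suc n - i) (?f i))"
      by simp
    also have "(\<Sum>i\<in>{1..n}. of_nat i * pavg (n - i) (?f (Suc i))) =
        (\<Sum>i\<in>{Suc 1..Suc n}. of_nat (i - 1) * pavg (Suc n - i) (?f i))"
      unfolding sum.shift_bounds_cl_Suc_ivl by simp
    also have "\<dots> = (\<Sum>i\<in>{1..Suc n}. of_nat (i - 1) * pavg (Suc n - i) (?f i))"
      by (rule sum.mono_neutral_left) auto
    also have "(\<Sum>i\<in>{1..Suc n}. of_nat (Suc n - i) * pavg (Suc n - i) (?f i)) + \<dots> =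
        (\<Sum>i\<in>{1..Suc n}. of_nat n * pavg (Suc n - i) (?f i))"
      unfolding sum.distrib [symmetric] distrib_right [symmetric] of_nat_add [symmetric]
      by (rule sum.cong) auto
    also have "\<dots> = of_nat n * (of_nat (Suc n) * pavg (Suc n) f)"
      unfolding pavg_Newton sum_distrib_left ..
    finally show ?thesis using False by simp
  qed
qed

section \<open>Building permutations by inserting points into cycles\<close>

lemma orbit_eq_if_mem:
  assumes "permutation p" "y \<in> orbit p x"
  shows "orbit p y = orbit p x"
  using assms by (meson cyclic_on_orbit' orbit_cyclic_eq3)

text \<open>Composing with the transposition puts the fixed point \<open>a\<close> directly before
  \<open>b\<close> in the cycle of \<open>b\<close>: the predecessor of \<open>b\<close> now goes to
  \<open>a\<close>, and \<open>a\<close> goes to \<open>b\<close>. All other cycles are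
  unchanged.\<close>

lemma orbit_transpose_insert:
  assumes X: "finite X" "a \<notin> X" "b \<in> X" and p: "p permutes X"
  shows "orbit (transpose a b \<circ> p) ` insert a X =
           insert (insert a (orbit p b)) (orbit p ` X - {orbit p b})"
proof -
  let ?g = "transpose a b \<circ> p" and ?O = "orbit p b"
  have pp: "permutation p" using p X by (auto simp: permutation_permutes)
  have "p permutes insert a X" using p by (rule permutes_subset) auto
  then have "?g permutes insert a X"
    using X by (intro permutes_compose permutes_swap_id) auto
  then have pg: "permutation ?g" using X by (auto simp: permutation_permutes)
  have O: "?O \<subseteq> X" using p X by (intro permutes_orbit_subset)
  have pa: "p a = a" using p X by (simp add: permutes_not_in)
  have ga: "?g a = b" by (simp add: pa)
  have bO: "b \<in> ?O" by (simp add: pp permutation_self_in_orbit)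
  have g_out: "?g y = p y" if "p y \<noteq> b" "y \<noteq> a" for y
    using that pa p by (metis comp_apply transpose_apply_other permutes_def)
  have g_in: "?g y = a" if "p y = b" for y using that by simp
  have 1: "orbit ?g a = insert a ?O"
  proof (intro equalityI subsetI)
    fix x assume "x \<in> orbit ?g a"
    then show "x \<in> insert a ?O"
    proof induction
      case base
      then show ?case using ga bO by simp
    next
      case (step y)
      show ?case
      proof (cases "y = a \<or> p y = b")
        case True
        then show ?thesis using ga g_in bO by auto
      next
        case False
        then have "p y \<in> ?O" using step by (auto intro: orbit.step)
        then show ?thesis using False by (simp add: g_out del: comp_apply)
      qed
    qed
  next
    have b: "b \<in> orbit ?g a" using orbit.base[of ?g a] ga by metis
    have a: "a \<in> orbit ?g a" by (simp add: pg permutation_self_in_orbit)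
    have step: "p y \<in> orbit ?g a" if "y \<in> orbit ?g a" "y \<in> X" for y
    proof (cases "p y = b")
      case True
      then show ?thesis using b by simp
    next
      case False
      then show ?thesis using orbit.step[OF that(1)] that X g_out[of y] by metis
    qed
    fix x assume "x \<in> insert a ?O"
    moreover have "x \<in> orbit ?g a" if "x \<in> ?O"
      using that
    proof induction
      case base
      show ?case using step b X by blast
    next
      case (step y)
      then show ?case using O \<open>\<And>y. y \<in> orbit ?g a \<Longrightarrow> y \<in> X \<Longrightarrow> p y \<in> orbit ?g a\<close> by blast
    qed
    ultimately show "x \<in> orbit ?g a" using a by blast
  qed
  have 2: "orbit ?g x = insert a ?O" if "x \<in> insert a ?O" for x
    using that orbit_eq_if_mem[OF pg, of x a] unfolding 1 by blast
  have 3: "orbit ?g x = orbit p x" if "x \<in> X" "x \<notin> ?O" for x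
  proof (rule orbit_cong)
    show "x \<in> orbit p x" by (simp add: pp permutation_self_in_orbit)
    fix y assume y: "y \<in> orbit p x"
    have "p y \<in> orbit p x" using y by (rule orbit.step)
    then have "p y \<noteq> b"
      using that orbit_eq_if_mem[OF pp, of b x] permutation_self_in_orbit[OF pp, of x] by metis
    moreover have "y \<noteq> a" using y permutes_orbit_subset[OF p that(1)] X by auto
    ultimately show "?g y = p y" by (rule g_out)
  qed
  have 4: "orbit p x = ?O \<longleftrightarrow> x \<in> ?O" for x
    using orbit_eq_if_mem[OF pp, of x b] permutation_self_in_orbit[OF pp, of x] by metis
  have "orbit ?g ` insert a X = orbit ?g ` insert a ?O \<union> orbit ?g ` (X - ?O)"
    using O by auto
  also have "orbit ?g ` insert a ?O = {insert a ?O}"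
    using 2 by auto
  also have "orbit ?g ` (X - ?O) = orbit p ` (X - ?O)"
    using 3 by (intro image_cong) auto
  also have "orbit p ` (X - ?O) = orbit p ` X - {?O}"
    using 4 by auto
  finally show ?thesis by (simp only: Un_insert_left Un_empty_left)
qed

lemma ctype_transpose_insert:
  assumes "finite X" "a \<notin> X" "b \<in> X" "p permutes X"
  shows "ctype (insert a X) (transpose a b \<circ> p) =
    add_mset (Suc (card (orbit p b))) (ctype X p - {#card (orbit p b)#})"
proof -
  let ?O = "orbit p b"
  have O: "?O \<subseteq> X" using assms by (intro permutes_orbit_subset)
  then have "finite ?O" "a \<notin> ?O" using assms finite_subset by auto
  moreover have "insert a ?O \<notin> orbit p ` X - {?O}"
    using assms permutes_orbit_subset[of p X] by blast
  moreover have "mset_set (orbit p ` X - {?O}) = mset_set (orbit p ` X) - {#?O#}"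
    using assms by (simp add: mset_set_Diff)
  moreover have "image_mset card (mset_set (orbit p ` X) - {#?O#}) = ctype X p - {#card ?O#}"
    using assms by (simp add: ctype_def image_mset_Diff)
  ultimately show ?thesis
    unfolding ctype_def orbit_transpose_insert[OF assms] using assms(1) by simp
qed

lemma ctype_insert_fixed:
  assumes "finite X" "a \<notin> X" "p permutes X"
  shows "ctype (insert a X) p = add_mset 1 (ctype X p)"
proof -
  have "orbit p a = {a}"
    using assms by (simp add: orbit_eq_singleton_iff permutes_not_in)
  moreover have "{a} \<notin> orbit p ` X"
    using assms permutes_orbit_subset[of p X] by blast
  ultimately show ?thesis
    using assms by (simp add: ctype_def)
qed

lemma sum_card_orbit:
  assumes "finite X" "p permutes X"
  shows "(\<Sum>b\<in>X. h (card (orbit p b))) = (\<Sum>j\<in>#ctype X p. of_nat j * h j :: 'b::semiring_1)"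
proof -
  have pp: "permutation p" using assms by (auto simp: permutation_permutes)
  have "(\<Sum>b\<in>X. h (card (orbit p b))) = (\<Sum>K\<in>orbit p ` X. \<Sum>b\<in>{b\<in>X. orbit p b = K}. h (card (orbit p b)))"
    using assms by (intro sum.image_gen)
  also have "\<dots> = (\<Sum>K\<in>orbit p ` X. of_nat (card K) * h (card K))"
  proof (rule sum.cong)
    fix K assume "K \<in> orbit p ` X"
    then obtain x where x: "x \<in> X" "K = orbit p x" by auto
    have "orbit p b = K \<longleftrightarrow> b \<in> K" for b
      using orbit_eq_if_mem[OF pp, of b x] permutation_self_in_orbit[OF pp, of b] x(2) by metis
    then have "{b\<in>X. orbit p b = K} = K"
      using permutes_orbit_subset[OF assms(2) x(1)] x(2) by blast
    moreover have "(\<Sum>b\<in>{b\<in>X. orbit p b = K}. h (card (orbit p b))) = (\<Sum>b\<in>{b\<in>X. orbit p b = K}. h (card K))"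
      by (rule sum.cong) auto
    ultimately show "(\<Sum>b\<in>{b\<in>X. orbit p b = K}. h (card (orbit p b))) = of_nat (card K) * h (card K)"
      by simp
  qed simp
  also have "\<dots> = (\<Sum>j\<in>#ctype X p. of_nat j * h j)"
    by (simp add: ctype_def sum_unfold_sum_mset image_mset.compositionality comp_def)
  finally show ?thesis .
qed

text \<open>Every permutation of \<open>insert a X\<close> is uniquely a transposition of
  \<open>a\<close> with some \<open>b\<close>, possibly \<open>a\<close> itself, after a permutation
  of \<open>X\<close>. The resulting recursion is that of \<open>pavg_Suc_insert\<close>, so class
  sizes need no separate count.\<close>

lemma sum_permutes_ctype:
  assumes "finite X"
  shows "(\<Sum>p | p permutes X. f (ctype X p)) = fact (card X) * pavg (card X) f"
  using assms
proof (induction X arbitrary: f)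
  case empty
  then show ?case by (simp add: ctype_def)
next
  case (insert a X)
  have "(\<Sum>p | p permutes insert a X. f (ctype (insert a X) p)) =
    (\<Sum>p | p permutes X. \<Sum>b\<in>insert a X. f (ctype (insert a X) (transpose a b \<circ> p)))"
    unfolding sum_over_permutations_insert[OF insert.hyps] by (rule sum.swap)
  also have "\<dots> = (\<Sum>p | p permutes X. f (add_mset 1 (ctype X p)) +
      (\<Sum>j\<in>#ctype X p. of_nat j * f (add_mset (Suc j) (ctype X p - {#j#}))))"
  proof (rule sum.cong)
    fix p assume "p \<in> {p. p permutes X}"
    then have p: "p permutes X" by simp
    have "(\<Sum>b\<in>insert a X. f (ctype (insert a X) (transpose a b \<circ> p))) =
        f (add_mset 1 (ctype X p)) +
        (\<Sum>b\<in>X. f (add_mset (Suc (card (orbit p b))) (ctype X p - {#card (orbit p b)#})))"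
      using insert.hyps p by (simp add: ctype_insert_fixed ctype_transpose_insert)
    then show "(\<Sum>b\<in>insert a X. f (ctype (insert a X) (transpose a b \<circ> p))) =
        f (add_mset 1 (ctype X p)) +
        (\<Sum>j\<in>#ctype X p. of_nat j * f (add_mset (Suc j) (ctype X p - {#j#})))"
      using sum_card_orbit[OF \<open>finite X\<close> p, of "\<lambda>j. f (add_mset (Suc j) (ctype X p - {#j#}))"]
      by simp
  qed simp
  also have "\<dots> = fact (card X) * (of_nat (Suc (card X)) * pavg (Suc (card X)) f)"
    unfolding insert.IH[of "\<lambda>M. f (add_mset 1 M) + (\<Sum>j\<in>#M. of_nat j * f (add_mset (Suc j) (M - {#j#})))"]
      pavg_Suc_insert ..
  finally show ?case
    using insert.hyps by (simp add: mult_ac)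
qed

text \<open>The average of the indicator function of \<open>M\<close> is
  \<open>1 / mset_z M\<close>, which is not 0.\<close>

lemma ex_permutes_ctype:
  assumes "finite X" "M \<in> pmsets (card X)"
  obtains p where "p permutes X" "ctype X p = M"
proof -
  have "pavg (card X) (\<lambda>N. if N = M then 1 else 0 :: real) =
      (\<Sum>N\<in>pmsets (card X). if N = M then 1 / of_nat (mset_z N) else 0)"
    unfolding pavg_def by (rule sum.cong) auto
  also have "\<dots> = 1 / of_nat (mset_z M)"
    using assms by simp
  also have "\<dots> \<noteq> 0"
    using mset_z_pos[of M] assms by (auto simp: pmsets_def)
  finally have "(\<Sum>p | p permutes X. if ctype X p = M then 1 else 0 :: real) \<noteq> 0"
    using sum_permutes_ctype[OF assms(1), of "\<lambda>N. if N = M then 1 else 0 :: real"] by simp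
  then obtain p where "p \<in> {p. p permutes X}" "(if ctype X p = M then 1 else 0 :: real) \<noteq> 0"
    by (rule sum.not_neutral_contains_not_neutral)
  then show thesis by (intro that[of p]) (auto split: if_splits)
qed


section \<open>Permutations of equal cycle type are conjugate\<close>

lemma image_mset_eq_imp_bij_betw:
  assumes "finite A" "finite B" "image_mset f (mset_set A) = image_mset g (mset_set B)"
  shows "\<exists>b. bij_betw b A B \<and> (\<forall>x\<in>A. g (b x) = f x)"
  using assms
proof (induction A arbitrary: B)
  case empty
  then have "B = {}" by (metis image_mset_is_empty_iff mset_set_empty_iff finite.emptyI)
  then show ?case by (auto simp: bij_betw_def)
next
  case (insert a A)
  then have "f a \<in># image_mset g (mset_set B)"
    by (metis finite.insertI image_eqI finite_set_mset_mset_set insertI1 set_image_mset)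
  then obtain y where y: "y \<in> B" "g y = f a" using insert by auto
  have "mset_set B = add_mset y (mset_set (B - {y}))"
    using y insert by (metis mset_set.remove)
  then have "image_mset f (mset_set A) = image_mset g (mset_set (B - {y}))"
    using insert y by simp
  from insert.IH[OF _ this] insert.prems obtain b where
    b: "bij_betw b A (B - {y})" "\<forall>x\<in>A. g (b x) = f x" by auto
  let ?b = "b(a := y)"
  have "bij_betw ?b A (B - {y})"
    using b(1) insert by (subst bij_betw_cong[where g = b]) auto
  then have "bij_betw ?b (A \<union> {a}) ((B - {y}) \<union> {y})"
    by (intro bij_betw_combine) (auto simp: bij_betw_def)
  moreover have "A \<union> {a} = insert a A" "(B - {y}) \<union> {y} = B" using y by auto
  moreover have "\<forall>x\<in>insert a A. g (?b x) = f x"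
    using b(2) y insert.hyps by auto
  ultimately show ?case by metis
qed

lemma funpow_eq_iff_mod_card_orbit:
  assumes "permutation p"
  shows "(p ^^ i) c = (p ^^ j) c \<longleftrightarrow> i mod card (orbit p c) = j mod card (orbit p c)"
proof -
  have c: "c \<in> orbit p c" using assms by (rule permutation_self_in_orbit)
  let ?N = "funpow_dist1 p c c"
  have N: "(p ^^ ?N) c = c" using c by (rule funpow_dist1_prop)
  have inj: "inj_on (\<lambda>n. (p ^^ n) c) {0..<?N}" using c by (rule inj_on_funpow_dist1)
  have "orbit p c = (\<lambda>n. (p ^^ n) c) ` {0..<?N}"
    using orbit_altdef_bounded[OF N] by auto
  then have card: "card (orbit p c) = ?N"
    using inj by (simp add: card_image)
  have "(p ^^ i) c = (p ^^ j) c \<longleftrightarrow> (p ^^ (i mod ?N)) c = (p ^^ (j mod ?N)) c"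
    unfolding funpow_mod_eq[OF N] ..
  also have "\<dots> \<longleftrightarrow> i mod ?N = j mod ?N"
    using inj_on_eq_iff[OF inj, of "i mod ?N" "j mod ?N"] by simp
  finally show ?thesis by (simp add: card)
qed

text \<open>Cycles of equal length are matched by \<open>b\<close>, a base point \<open>c\<close> is
  chosen in each cycle, and \<open>h\<close> sends the \<open>i\<close>-th iterate of a base point
  under \<open>p\<close> to the \<open>i\<close>-th iterate of the matching base point under
  \<open>q\<close>.\<close>

lemma conjugate_if_ctype_eq:
  assumes X: "finite X" and p: "p permutes X" and q: "q permutes X" and eq: "ctype X p = ctype X q"
  obtains h where "h permutes X" "h \<circ> p = q \<circ> h"
proof -
  have pp: "permutation p" "permutation q" using p q X by (auto simp: permutation_permutes)
  obtain b where b: "bij_betw b (orbit p ` X) (orbit q ` X)"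
      "\<And>x. x \<in> X \<Longrightarrow> card (b (orbit p x)) = card (orbit p x)"
    using image_mset_eq_imp_bij_betw[of "orbit p ` X" "orbit q ` X" card card] X eq
    by (auto simp: ctype_def)
  define c where "c K = (SOME x. x \<in> K)" for K :: "'a set"
  have c: "c K \<in> K" if "K \<noteq> {}" for K using that by (auto simp: c_def some_in_eq)
  have cp: "orbit p (c (orbit p x)) = orbit p x" for x
    by (intro orbit_eq_if_mem pp c orbit_nonempty)
  have cq: "orbit q (c (b (orbit p x))) = b (orbit p x)" if "x \<in> X" for x
  proof -
    have "b (orbit p x) \<in> orbit q ` X" using bij_betw_apply[OF b(1)] that by blast
    then obtain y where "b (orbit p x) = orbit q y" by blast
    then show ?thesis using orbit_eq_if_mem[OF pp(2) c[OF orbit_nonempty]] by metis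
  qed
  define i where "i x = funpow_dist p (c (orbit p x)) x" for x
  have i: "(p ^^ i x) (c (orbit p x)) = x" for x
    unfolding i_def using permutation_self_in_orbit[OF pp(1), of x]
    by (intro funpow_dist_prop) (simp only: cp)
  define h where "h x = (if x \<in> X then (q ^^ i x) (c (b (orbit p x))) else x)" for x
  have hO: "h x \<in> b (orbit p x)" if "x \<in> X" for x
  proof -
    have "h x \<in> orbit q (c (b (orbit p x)))"
      using that by (simp add: h_def funpow_in_orbit permutation_self_in_orbit pp)
    then show ?thesis using that by (simp add: cq)
  qed
  have orbq: "orbit q (h x) = b (orbit p x)" if "x \<in> X" for x
    using orbit_eq_if_mem[OF pp(2), of "h x" "c (b (orbit p x))"] hO[OF that] cq[OF that] by simp
  \<comment> \<open>Matched cycles have the same length, and equality of iterates depends only on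
    the exponents modulo that length. Injectivity of \<open>h\<close> and its compatibility with
    \<open>p\<close> and \<open>q\<close> both rest on this.\<close>
  have transfer: "(p ^^ k) (c (orbit p x)) = (p ^^ l) (c (orbit p x)) \<longleftrightarrow>
      (q ^^ k) (c (b (orbit p x))) = (q ^^ l) (c (b (orbit p x)))" if "x \<in> X" for x k l
    using that by (simp add: funpow_eq_iff_mod_card_orbit pp cp cq b(2))
  have hX: "h ` X \<subseteq> X"
  proof
    fix y assume "y \<in> h ` X"
    then obtain x where x: "x \<in> X" "y = h x" by auto
    have "b (orbit p x) \<in> orbit q ` X" using bij_betw_apply[OF b(1)] x by blast
    then obtain z where "z \<in> X" "b (orbit p x) = orbit q z" by auto
    then show "y \<in> X" using hO[OF x(1)] x permutes_orbit_subset[OF q] by blast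
  qed
  have "inj_on h X"
  proof (rule inj_onI)
    fix x y assume xy: "x \<in> X" "y \<in> X" "h x = h y"
    then have "b (orbit p x) = b (orbit p y)" using orbq[of x] orbq[of y] by simp
    then have O: "orbit p x = orbit p y"
      using inj_onD[OF bij_betw_imp_inj_on[OF b(1)], of "orbit p x" "orbit p y"] xy by simp
    have "(q ^^ i x) (c (b (orbit p x))) = (q ^^ i y) (c (b (orbit p x)))"
      using xy O by (simp add: h_def)
    then have "(p ^^ i x) (c (orbit p x)) = (p ^^ i y) (c (orbit p x))"
      unfolding transfer[OF xy(1)] .
    then show "x = y" using i[of x] i[of y] unfolding O by simp
  qed
  then have "bij_betw h X X"
    using hX X by (simp add: bij_betw_def endo_inj_surj)
  then have h: "h permutes X"
    by (rule bij_imp_permutes) (simp add: h_def)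
  have "h (p x) = q (h x)" for x
  proof (cases "x \<in> X")
    case True
    then have px: "p x \<in> X" using p by (simp add: permutes_in_image)
    have O: "orbit p (p x) = orbit p x" by (simp add: permutation_orbit_step pp)
    have "(p ^^ i (p x)) (c (orbit p x)) = (p ^^ Suc (i x)) (c (orbit p x))"
      using i[of "p x"] i[of x] O by simp
    then have "(q ^^ i (p x)) (c (b (orbit p x))) = (q ^^ Suc (i x)) (c (b (orbit p x)))"
      unfolding transfer[OF True] .
    then show ?thesis using True px O by (simp add: h_def)
  next
    case False
    then show ?thesis using p q by (simp add: h_def permutes_not_in)
  qed
  then have "h \<circ> p = q \<circ> h" by auto
  with h that show thesis by blast
qed


section \<open>Averages over Young subgroups\<close>

text \<open>The blocks are the fibres of the labelling \<open>r\<close>; with \<open>row_of\<close>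
  and \<open>col_of\<close> this covers both the row and the column group.\<close>

definition young_subgroup :: "('a \<Rightarrow> 'b) \<Rightarrow> 'a set \<Rightarrow> ('a \<Rightarrow> 'a) set" where
  "young_subgroup r X = {p. p permutes X \<and> (\<forall>x\<in>X. r (p x) = r x)}"

lemma ctype_compose_disjoint:
  assumes "finite X" "finite Y" "X \<inter> Y = {}" "p permutes X" "q permutes Y"
  shows "ctype (X \<union> Y) (p \<circ> q) = ctype X p + ctype Y q"
proof -
  have q: "q x = x" if "x \<notin> Y" for x using that assms by (auto simp: permutes_not_in)
  have p: "p x = x" if "x \<notin> X" for x using that assms by (auto simp: permutes_not_in)
  have 1: "orbit (p \<circ> q) x = orbit p x" if "x \<in> X" for x
  proof (rule orbit_cong)
    show "x \<in> orbit p x" using assms by (intro permutation_self_in_orbit) (auto simp: permutation_permutes)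
    fix s assume "s \<in> orbit p x"
    then have "s \<notin> Y" using permutes_orbit_subset[OF assms(4) that] assms(3) by blast
    then show "(p \<circ> q) s = p s" by (simp add: q)
  qed
  have 2: "orbit (p \<circ> q) x = orbit q x" if "x \<in> Y" for x
  proof (rule orbit_cong)
    show "x \<in> orbit q x" using assms by (intro permutation_self_in_orbit) (auto simp: permutation_permutes)
    fix s assume "s \<in> orbit q x"
    then have "q s \<in> Y" using orbit.step permutes_orbit_subset[OF assms(5) that] by fast
    then show "(p \<circ> q) s = q s" using assms p by auto
  qed
  have "orbit p x \<noteq> orbit q y" if "x \<in> X" "y \<in> Y" for x y
    using permutes_orbit_subset[OF assms(4) that(1)] permutes_orbit_subset[OF assms(5) that(2)]
      assms(3) orbit_nonempty[of p x] by blast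
  then have "orbit p ` X \<inter> orbit q ` Y = {}" by auto
  moreover have "orbit (p \<circ> q) ` (X \<union> Y) = orbit p ` X \<union> orbit q ` Y"
    by (simp add: image_Un 1 2 cong: image_cong_simp)
  ultimately show ?thesis
    using assms by (simp add: ctype_def mset_set_Union)
qed

text \<open>One block splits off as a direct factor. The inverse restricts a permutation to the
  block \<open>Y\<close> and to its complement, both invariant because labels are preserved.\<close>

lemma bij_betw_young_subgroup:
  fixes r :: "'a \<Rightarrow> 'b" and k X
  defines "Y \<equiv> {x\<in>X. r x = k}"
  shows "bij_betw (\<lambda>(p, q). p \<circ> q) ({p. p permutes Y} \<times> young_subgroup r (X - Y)) (young_subgroup r X)"
proof (rule bij_betw_byWitness[where f' = "\<lambda>p. (restrict_id p Y, restrict_id p (X - Y))"])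
  have Y: "x \<in> Y \<longleftrightarrow> x \<in> X \<and> r x = k" for x by (simp add: Y_def)
  show "\<forall>a\<in>{p. p permutes Y} \<times> young_subgroup r (X - Y).
      (\<lambda>p. (restrict_id p Y, restrict_id p (X - Y))) (case a of (p, q) \<Rightarrow> p \<circ> q) = a"
  proof
    fix a assume "a \<in> {p. p permutes Y} \<times> young_subgroup r (X - Y)"
    then obtain p q where a: "a = (p, q)" and p: "p permutes Y" and q: "q permutes (X - Y)"
      by (auto simp: young_subgroup_def)
    have "restrict_id (p \<circ> q) Y x = p x" for x
      using p q by (cases "x \<in> Y") (auto simp: permutes_not_in)
    moreover have "restrict_id (p \<circ> q) (X - Y) x = q x" for x
    proof (cases "x \<in> X - Y")
      case True
      then have "q x \<in> X - Y" using permutes_in_image[OF q, of x] by blast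
      then show ?thesis using True p by (simp add: permutes_not_in)
    next
      case False
      then show ?thesis using permutes_not_in[OF q False] restrict_id_simps(2)[OF False] by metis
    qed
    ultimately show "(\<lambda>p. (restrict_id p Y, restrict_id p (X - Y))) (case a of (p, q) \<Rightarrow> p \<circ> q) = a"
      by (simp add: a fun_eq_iff)
  qed
  have rst: "p permutes X" "r (p x) = r x" if "p \<in> young_subgroup r X" for p x
    using that by (cases "x \<in> X"; auto simp: young_subgroup_def permutes_not_in)+
  show "\<forall>a'\<in>young_subgroup r X. (case (restrict_id a' Y, restrict_id a' (X - Y)) of (p, q) \<Rightarrow> p \<circ> q) = a'"
  proof
    fix p assume p: "p \<in> young_subgroup r X"
    have "restrict_id p Y (restrict_id p (X - Y) x) = p x" for x
    proof (cases "x \<in> X - Y")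
      case True
      then have "p x \<notin> Y" using rst[OF p] by (auto simp: Y)
      with True show ?thesis by (simp add: restrict_id_def)
    next
      case False
      then show ?thesis using rst[OF p] by (cases "x \<in> Y") (auto simp: Y permutes_not_in)
    qed
    then show "(case (restrict_id p Y, restrict_id p (X - Y)) of (p, q) \<Rightarrow> p \<circ> q) = p"
      by (simp add: fun_eq_iff)
  qed
  show "(\<lambda>(p, q). p \<circ> q) ` ({p. p permutes Y} \<times> young_subgroup r (X - Y)) \<subseteq> young_subgroup r X"
  proof
    fix g assume "g \<in> (\<lambda>(p, q). p \<circ> q) ` ({p. p permutes Y} \<times> young_subgroup r (X - Y))"
    then obtain p q where g: "g = p \<circ> q" and p: "p permutes Y" and q: "q \<in> young_subgroup r (X - Y)"
      by auto
    have q': "q permutes X - Y" "\<And>x. x \<in> X - Y \<Longrightarrow> r (q x) = r x"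
      using q by (auto simp: young_subgroup_def)
    have "p permutes X" "q permutes X" using p q'(1) by (auto intro: permutes_subset simp: Y_def)
    then have "g permutes X" unfolding g by (intro permutes_compose)
    moreover have "r (g x) = r x" if "x \<in> X" for x
    proof (cases "x \<in> Y")
      case True
      then have "p x \<in> Y" using p by (simp add: permutes_in_image)
      then show ?thesis using True q' by (simp add: g permutes_not_in Y)
    next
      case False
      then have "q x \<in> X - Y" using permutes_in_image[OF q'(1), of x] that by blast
      then show ?thesis using p q' that False by (simp add: g permutes_not_in)
    qed
    ultimately show "g \<in> young_subgroup r X" by (simp add: young_subgroup_def)
  qed
  show "(\<lambda>p. (restrict_id p Y, restrict_id p (X - Y))) ` young_subgroup r X \<subseteq>
      {p. p permutes Y} \<times> young_subgroup r (X - Y)"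
  proof
    fix a assume "a \<in> (\<lambda>p. (restrict_id p Y, restrict_id p (X - Y))) ` young_subgroup r X"
    then obtain p where p: "p \<in> young_subgroup r X" and a: "a = (restrict_id p Y, restrict_id p (X - Y))"
      by auto
    note p' = rst[OF p]
    have mem: "p x \<in> X \<longleftrightarrow> x \<in> X" "p x \<in> Y \<longleftrightarrow> x \<in> Y" for x
      using p' by (auto simp: Y permutes_in_image)
    have bij: "bij_betw p A A" if A: "\<And>x. p x \<in> A \<longleftrightarrow> x \<in> A" for A
    proof -
      have "y \<in> p ` A" if "y \<in> A" for y
      proof -
        obtain z where "y = p z" using permutes_surj[OF p'(1)] by (metis surjD)
        then show ?thesis using that A by blast
      qed
      then show ?thesis using A p'(1) by (auto simp: bij_betw_def permutes_inj_on)
    qed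
    have "bij_betw p Y Y" "bij_betw p (X - Y) (X - Y)"
      by (auto intro!: bij simp: mem)
    then show "a \<in> {p. p permutes Y} \<times> young_subgroup r (X - Y)"
      using p' by (auto simp: a young_subgroup_def permutes_restrict_id)
  qed
qed

text \<open>Averaging over the symmetric group of one block \<open>Y\<close> turns \<open>f\<close>
  into \<open>skew 1 (card Y) f\<close>, which is the recursion of \<open>hpair\<close>. A label
  with empty fibre contributes a part 0.\<close>

lemma sum_young_subgroup_ctype:
  assumes "finite X" "distinct ks" "r ` X \<subseteq> set ks"
  shows "(\<Sum>p\<in>young_subgroup r X. f (ctype X p)) =
    of_nat (card (young_subgroup r X)) * hpair (map (\<lambda>k. card {x\<in>X. r x = k}) ks) f"
  using assms
proof (induction ks arbitrary: X f)
  case Nil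
  then have "X = {}" by auto
  then show ?case by (simp add: young_subgroup_def ctype_def)
next
  case (Cons k ks)
  define Y where "Y = {x\<in>X. r x = k}"
  let ?G = "young_subgroup r (X - Y)"
  have fin: "finite Y" "finite (X - Y)" using Cons.prems by (auto simp: Y_def)
  note bij = bij_betw_young_subgroup[of X r k, folded Y_def]
  have XY: "X = Y \<union> (X - Y)" by (auto simp: Y_def)
  have "map (\<lambda>k. card {x\<in>X - Y. r x = k}) ks = map (\<lambda>k. card {x\<in>X. r x = k}) ks"
    using Cons.prems by (intro map_cong refl arg_cong[where f = card]) (auto simp: Y_def)
  moreover have "(\<Sum>q\<in>?G. skew 1 (card Y) f (ctype (X - Y) q)) =
      of_nat (card ?G) * hpair (map (\<lambda>k. card {x\<in>X - Y. r x = k}) ks) (skew 1 (card Y) f)"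
    using Cons.prems by (intro Cons.IH) (auto simp: Y_def)
  ultimately have IH: "(\<Sum>q\<in>?G. skew 1 (card Y) f (ctype (X - Y) q)) =
      of_nat (card ?G) * hpair (map (\<lambda>k. card {x\<in>X. r x = k}) (k # ks)) f"
    unfolding list.map hpair.simps Y_def[symmetric] by (simp only:)
  have card: "card (young_subgroup r X) = fact (card Y) * card ?G"
    using bij_betw_same_card[OF bij] fin by (simp add: card_cartesian_product card_permutations)
  have "(\<Sum>p\<in>young_subgroup r X. f (ctype X p)) =
      (\<Sum>(p, q)\<in>{p. p permutes Y} \<times> ?G. f (ctype X (p \<circ> q)))"
    by (subst sum.reindex_bij_betw[OF bij, symmetric]) (simp add: case_prod_unfold)
  also have "\<dots> = (\<Sum>q\<in>?G. \<Sum>p | p permutes Y. f (ctype X (p \<circ> q)))"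
    unfolding sum.cartesian_product [symmetric] by (rule sum.swap)
  also have "\<dots> = (\<Sum>q\<in>?G. \<Sum>p | p permutes Y. f (ctype (X - Y) q + ctype Y p))"
  proof (intro sum.cong refl)
    fix q p assume "q \<in> ?G" "p \<in> {p. p permutes Y}"
    then have "ctype (Y \<union> (X - Y)) (p \<circ> q) = ctype Y p + ctype (X - Y) q"
      using fin by (intro ctype_compose_disjoint) (auto simp: young_subgroup_def)
    then show "f (ctype X (p \<circ> q)) = f (ctype (X - Y) q + ctype Y p)"
      using XY by (simp add: add.commute)
  qed
  also have "\<dots> = (\<Sum>q\<in>?G. fact (card Y) * skew 1 (card Y) f (ctype (X - Y) q))"
    using sum_permutes_ctype[OF fin(1), of "\<lambda>M. f (ctype (X - Y) _ + M)"]
    by (intro sum.cong) (simp_all add: skew_def)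
  also have "\<dots> = fact (card Y) * (\<Sum>q\<in>?G. skew 1 (card Y) f (ctype (X - Y) q))"
    by (simp add: sum_distrib_left)
  finally show ?case
    unfolding IH card by simp
qed


section \<open>Traces on subspaces\<close>

context vector_space
begin

text \<open>Expanding \<open>b\<close> in \<open>E\<close> and \<open>T e\<close> in
  \<open>B\<close> gives the same double sum for both traces, as in
  \<open>tr (P Q) = tr (Q P)\<close>.\<close>

lemma trace_basis_independent:
  assumes B: "finite B" "independent B" and E: "finite E" "independent E" and span: "span B = span E"
    and T: "Vector_Spaces.linear scale scale T" "\<And>v. v \<in> span E \<Longrightarrow> T v \<in> span E"
  shows "(\<Sum>b\<in>B. representation B (T b) b) = (\<Sum>e\<in>E. representation E (T e) e)"
proof -
  interpret T: Vector_Spaces.linear scale scale T by (rule T(1))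
  have mem: "b \<in> span E" if "b \<in> B" for b using span_base[OF that] span by simp
  have TE: "T e \<in> span B" if "e \<in> E" for e using T(2)[OF span_base[OF that]] span by simp
  have 1: "representation B (T b) b = (\<Sum>e\<in>E. representation E b e * representation B (T e) b)" if b: "b \<in> B" for b
  proof -
    have "T b = T (\<Sum>e\<in>E. scale (representation E b e) e)"
      using sum_representation_eq[OF E(2) mem[OF b] E(1) subset_refl] by simp
    also have "\<dots> = (\<Sum>e\<in>E. scale (representation E b e) (T e))"
      by (simp add: T.sum T.scale)
    finally have "representation B (T b) = representation B \<dots>" by simp
    also have "\<dots> = (\<lambda>x. \<Sum>e\<in>E. representation E b e * representation B (T e) x)"
      using TE by (simp add: representation_sum[OF B(2)] representation_scale[OF B(2)] span_scale)
    finally show ?thesis by simp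
  qed
  have 2: "representation E (T e) e = (\<Sum>b\<in>B. representation B (T e) b * representation E b e)" if e: "e \<in> E" for e
  proof -
    have "representation E (T e) = representation E (\<Sum>b\<in>B. scale (representation B (T e) b) b)"
      using sum_representation_eq[OF B(2) TE[OF e] B(1) subset_refl] by simp
    also have "\<dots> = (\<lambda>x. \<Sum>b\<in>B. representation B (T e) b * representation E b x)"
      using mem by (simp add: representation_sum[OF E(2)] representation_scale[OF E(2)] span_scale)
    finally show ?thesis by simp
  qed
  have "(\<Sum>b\<in>B. representation B (T b) b) = (\<Sum>b\<in>B. \<Sum>e\<in>E. representation E b e * representation B (T e) b)"
    by (simp add: 1)
  also have "\<dots> = (\<Sum>e\<in>E. \<Sum>b\<in>B. representation B (T e) b * representation E b e)"
    by (subst sum.swap) (simp add: mult.commute)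
  also have "\<dots> = (\<Sum>e\<in>E. representation E (T e) e)"
    by (simp add: 2)
  finally show ?thesis .
qed

text \<open>If \<open>S\<close> is \<open>k\<close> times a projection onto \<open>V\<close>, the trace on \<open>V\<close> can be computed
  on the whole space, since \<open>T \<circ> S\<close> has diagonal entry 0 at the basis vectors outside \<open>V\<close>.\<close>

lemma trace_on_eq_trace_comp:
  assumes E: "finite E" "independent E"
    and S: "Vector_Spaces.linear scale scale S" "S ` span E = V" "V \<subseteq> span E"
      "\<And>v. v \<in> V \<Longrightarrow> S v = scale k v"
    and T: "Vector_Spaces.linear scale scale T" "\<And>v. v \<in> V \<Longrightarrow> T v \<in> V"
  shows "k * trace_on V T = (\<Sum>e\<in>E. representation E (T (S e)) e)"
proof -
  interpret S: Vector_Spaces.linear scale scale S by (rule S(1))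
  interpret T: Vector_Spaces.linear scale scale T by (rule T(1))
  have TS: "Vector_Spaces.linear scale scale (\<lambda>x. T (S x))"
    using Vector_Spaces.linear_compose[OF S(1) T(1)] by (simp add: comp_def)
  have "subspace V"
    unfolding S(2)[symmetric] by (intro S.subspace_image subspace_span)
  then have spV: "span V = V" by (simp add: span_eq_iff)
  \<comment> \<open>This is the very basis chosen in \<open>trace_on\<close>; it is extended below
    to a basis \<open>B'\<close> of the whole space.\<close>
  define B where "B = (SOME B. B \<subseteq> V \<and> independent B \<and> span B = V)"
  have "\<exists>B. B \<subseteq> V \<and> independent B \<and> span B = V"
    using maximal_independent_subset[of V] spV
    by (metis span_mono span_subspace subset_antisym)
  then have B: "B \<subseteq> V" "independent B" "span B = V"
    unfolding B_def by (metis (mono_tags, lifting) someI_ex)+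
  obtain B' where B': "B \<subseteq> B'" "B' \<subseteq> span E" "independent B'" "span E \<subseteq> span B'"
    using maximal_independent_subset_extend[of B "span E"] B S(3) by (metis order_trans)
  have spB': "span B' = span E"
    using B'(2,4) span_mono[OF B'(2)] by (simp add: span_span subset_antisym)
  have fB': "finite B'"
    using independent_span_bound[OF E(1) B'(3) B'(2)] by blast
  have TSV: "T (S x) \<in> V" if "x \<in> span E" for x
    using T(2) S(2) that by blast
  have "(\<Sum>e\<in>E. representation E (T (S e)) e) = (\<Sum>b\<in>B'. representation B' (T (S b)) b)"
    using TSV S(3) by (intro trace_basis_independent[symmetric] fB' B' E spB' TS) blast
  also have "\<dots> = (\<Sum>b\<in>B. k * representation B (T b) b)"
  proof (rule sum.mono_neutral_cong_right[OF fB' B'(1)])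
    show "\<forall>b\<in>B' - B. representation B' (T (S b)) b = 0"
    proof
      fix b assume b: "b \<in> B' - B"
      then have "T (S b) \<in> span B" using TSV B'(2) B(3) by blast
      then have "representation B' (T (S b)) = representation B (T (S b))"
        using B'(1,3) by (intro representation_extend)
      then show "representation B' (T (S b)) b = 0"
        using b representation_ne_zero[of B "T (S b)" b] by auto
    qed
    fix b assume b: "b \<in> B"
    then have "T b \<in> span B" using B T(2) by blast
    moreover have "T (S b) = scale k (T b)"
      using S(4) b B(1) by (simp add: subset_iff T.scale)
    moreover from \<open>T b \<in> span B\<close> have "representation B' (scale k (T b)) = representation B (scale k (T b))"
      using B'(1,3) by (intro representation_extend span_scale)
    ultimately show "representation B' (T (S b)) b = k * representation B (T b) b"
      using B(2) by (simp add: representation_scale)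
  qed
  also have "\<dots> = k * trace_on V T"
    by (simp add: trace_on_def B_def [symmetric] sum_distrib_left)
  finally show ?thesis ..
qed

end


section \<open>Convolution in the group algebra\<close>

definition perms :: "nat \<Rightarrow> (nat \<Rightarrow> nat) set" where
  "perms n = {p. p permutes {1..n}}"

lemma perms_compose [simp]: "p \<in> perms n \<Longrightarrow> q \<in> perms n \<Longrightarrow> p \<circ> q \<in> perms n"
  unfolding perms_def by (simp add: permutes_compose)

lemma perms_inv [simp]: "p \<in> perms n \<Longrightarrow> inv p \<in> perms n"
  unfolding perms_def by (simp add: permutes_inv)

lemma perms_id [simp]: "id \<in> perms n"
  unfolding perms_def by (simp add: permutes_id)

lemma finite_perms [simp]: "finite (perms n)"
  unfolding perms_def by (simp add: finite_permutations)

lemma sum_fun_apply: "(\<Sum>i\<in>I. f i) x = (\<Sum>i\<in>I. f i x)"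
  by (induction I rule: infinite_finite_induct) simp_all

lemma perms_cancel:
  assumes "p \<in> perms n"
  shows "p \<circ> inv p = id" "inv p \<circ> p = id" "p \<circ> (inv p \<circ> x) = x" "inv p \<circ> (p \<circ> x) = x"
    "x \<circ> p \<circ> inv p = x" "x \<circ> inv p \<circ> p = x" "inv (inv p) = p"
  using assms permutes_inv_o[of p "{1..n}"] permutes_inv_inv[of p "{1..n}"]
  unfolding perms_def by (simp_all add: fun_eq_iff)

lemma perms_inv_compose:
  "p \<in> perms n \<Longrightarrow> q \<in> perms n \<Longrightarrow> inv (p \<circ> q) = inv q \<circ> inv p"
  unfolding perms_def by (auto simp: o_inv_distrib permutes_bij)

lemma sum_perms_left: "q \<in> perms n \<Longrightarrow> (\<Sum>p\<in>perms n. f (q \<circ> p)) = (\<Sum>p\<in>perms n. f p)"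
  by (rule sum.reindex_bij_witness[where i = "\<lambda>p. inv q \<circ> p" and j = "\<lambda>p. q \<circ> p"])
    (auto simp: perms_cancel[of q n])

lemma sum_perms_inv: "(\<Sum>p\<in>perms n. f (inv p)) = (\<Sum>p\<in>perms n. f p)"
  by (rule sum.reindex_bij_witness[where i = inv and j = inv])
    (auto simp: perms_cancel[of _ n])

lemma sum_perms_conj:
  assumes "q \<in> perms n"
  shows "(\<Sum>p\<in>perms n. f (q \<circ> p \<circ> inv q)) = (\<Sum>p\<in>perms n. f p)"
  by (rule sum.reindex_bij_witness[where i = "\<lambda>p. inv q \<circ> p \<circ> q" and j = "\<lambda>p. q \<circ> p \<circ> inv q"])
    (use assms in \<open>simp_all add: comp_assoc perms_cancel[OF assms]\<close>)

lemma galg_mult_apply: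
  "galg_mult n x y g = (if g \<in> perms n then \<Sum>h\<in>perms n. x h * y (inv h \<circ> g) else 0)"
proof -
  have def: "galg_mult n x y g =
      (\<Sum>(h, k) | h \<in> perms n \<and> k \<in> perms n \<and> h \<circ> k = g. x h * y k)"
    by (simp add: galg_mult_def perms_def)
  show ?thesis
  proof (cases "g \<in> perms n")
    case True
    have "galg_mult n x y g = (\<Sum>h\<in>perms n. x h * y (inv h \<circ> g))"
      unfolding def
      by (rule sum.reindex_bij_witness[where i = "\<lambda>h. (h, inv h \<circ> g)" and j = fst])
        (use True in \<open>auto simp: perms_cancel[of _ n]\<close>)
    with True show ?thesis by simp
  next
    case False
    then have "{(h, k). h \<in> perms n \<and> k \<in> perms n \<and> h \<circ> k = g} = {}"
      using perms_compose by blast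
    then have "galg_mult n x y g = 0"
      unfolding def by (simp only: sum.empty)
    with False show ?thesis by simp
  qed
qed

lemma galg_carrier_iff: "x \<in> galg_carrier n \<longleftrightarrow> (\<forall>g. g \<notin> perms n \<longrightarrow> x g = 0)"
  by (simp add: galg_carrier_def perms_def)

lemma galg_mult_in_carrier: "galg_mult n x y \<in> galg_carrier n"
  by (simp add: galg_carrier_iff galg_mult_apply)

lemma galg_mult_assoc:
  "galg_mult n (galg_mult n x y) z = galg_mult n x (galg_mult n y z)"
proof
  fix g
  show "galg_mult n (galg_mult n x y) z g = galg_mult n x (galg_mult n y z) g"
  proof (cases "g \<in> perms n")
    case True
    have "galg_mult n (galg_mult n x y) z g =
        (\<Sum>h\<in>perms n. \<Sum>k\<in>perms n. x k * y (inv k \<circ> h) * z (inv h \<circ> g))"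
      using True by (simp add: galg_mult_apply sum_distrib_right)
    also have "\<dots> = (\<Sum>k\<in>perms n. \<Sum>h\<in>perms n. x k * y (inv k \<circ> h) * z (inv h \<circ> g))"
      by (rule sum.swap)
    also have "\<dots> = (\<Sum>k\<in>perms n. \<Sum>h\<in>perms n. x k * y h * z (inv h \<circ> (inv k \<circ> g)))"
    proof (rule sum.cong)
      fix k assume k: "k \<in> perms n"
      have "(\<Sum>h\<in>perms n. x k * y (inv k \<circ> h) * z (inv h \<circ> g)) =
        (\<Sum>h\<in>perms n. x k * y (inv k \<circ> (k \<circ> h)) * z (inv (k \<circ> h) \<circ> g))"
        by (rule sum_perms_left[OF k, symmetric])
      also have "\<dots> = (\<Sum>h\<in>perms n. x k * y h * z (inv h \<circ> (inv k \<circ> g)))"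
        by (rule sum.cong) (simp_all only: perms_cancel[OF k] perms_inv_compose[OF k] comp_assoc)
      finally show "(\<Sum>h\<in>perms n. x k * y (inv k \<circ> h) * z (inv h \<circ> g)) = \<dots>" .
    qed simp
    also have "\<dots> = galg_mult n x (galg_mult n y z) g"
      using True by (simp add: galg_mult_apply sum_distrib_left mult.assoc)
    finally show ?thesis .
  qed (simp add: galg_mult_apply)
qed

lemma linear_galg_mult_left:
  "Vector_Spaces.linear galg_scale galg_scale (\<lambda>x. galg_mult n x y)"
  by unfold_locales
    (auto simp: fun_eq_iff galg_mult_apply galg_scale_def algebra_simps sum.distrib sum_distrib_left)

lemma linear_galg_mult_right:
  "Vector_Spaces.linear galg_scale galg_scale (\<lambda>y. galg_mult n x y)"
  by unfold_locales
    (auto simp: fun_eq_iff galg_mult_apply galg_scale_def algebra_simps sum.distrib sum_distrib_left)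

lemma galg_mult_scale_left: "galg_mult n (galg_scale c x) y = galg_scale c (galg_mult n x y)"
  by (simp add: fun_eq_iff galg_mult_apply galg_scale_def sum_distrib_left mult_ac)

lemma galg_mult_scale_right: "galg_mult n x (galg_scale c y) = galg_scale c (galg_mult n x y)"
  by (simp add: fun_eq_iff galg_mult_apply galg_scale_def sum_distrib_left mult_ac)

lemma galg_mult_sum_left: "galg_mult n (\<Sum>i\<in>I. f i) y = (\<Sum>i\<in>I. galg_mult n (f i) y)"
proof -
  interpret Vector_Spaces.linear galg_scale galg_scale "\<lambda>x. galg_mult n x y"
    by (rule linear_galg_mult_left)
  show ?thesis by (rule sum)
qed

lemma galg_mult_sum_right: "galg_mult n x (\<Sum>i\<in>I. f i) = (\<Sum>i\<in>I. galg_mult n x (f i))"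
proof -
  interpret Vector_Spaces.linear galg_scale galg_scale "\<lambda>y. galg_mult n x y"
    by (rule linear_galg_mult_right)
  show ?thesis by (rule sum)
qed

lemma galg_mult_single_left:
  "p \<in> perms n \<Longrightarrow> galg_mult n (galg_single p) y g = (if g \<in> perms n then y (inv p \<circ> g) else 0)"
  using finite_perms[of n] by (simp add: galg_mult_apply galg_single_def if_distrib[of "\<lambda>a. a * _"] cong: if_cong)

lemma galg_mult_single_right:
  assumes p: "p \<in> perms n"
  shows "galg_mult n y (galg_single p) g = (if g \<in> perms n then y (g \<circ> inv p) else 0)"
proof (cases "g \<in> perms n")
  case True
  have "inv h \<circ> g = p \<longleftrightarrow> h = g \<circ> inv p" if "h \<in> perms n" for h
    using that p perms_cancel[OF p] perms_cancel[OF that] by (metis comp_assoc comp_id)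
  then have "y h * galg_single p (inv h \<circ> g) = (if h = g \<circ> inv p then y h else 0)" if "h \<in> perms n" for h
    using that by (simp add: galg_single_def)
  then have "galg_mult n y (galg_single p) g = (\<Sum>h\<in>perms n. if h = g \<circ> inv p then y h else 0)"
    unfolding galg_mult_apply using True by (simp cong: sum.cong)
  then show ?thesis
    using True p by simp
qed (simp add: galg_mult_apply)

lemma galg_mult_single_single:
  assumes "p \<in> perms n" "q \<in> perms n"
  shows "galg_mult n (galg_single p) (galg_single q) = galg_single (p \<circ> q)"
proof
  fix g
  have "inv p \<circ> g = q \<longleftrightarrow> g = p \<circ> q"
    using perms_cancel[OF assms(1)] by metis
  moreover have "p \<circ> q \<in> perms n" using assms by (rule perms_compose)
  ultimately show "galg_mult n (galg_single p) (galg_single q) g = galg_single (p \<circ> q) g"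
    using assms(1) by (auto simp: galg_mult_single_left) (auto simp: galg_single_def)
qed

lemma galg_mult_at_id: "galg_mult n x y id = (\<Sum>h\<in>perms n. x h * y (inv h))"
  using perms_id[of n] by (simp add: galg_mult_apply)

text \<open>The coefficient at the identity is a trace form on the group algebra. Its cyclicity is
  what moves factors around in the character computations.\<close>

lemma galg_mult_at_id_commute: "galg_mult n x y id = galg_mult n y x id"
proof -
  have "galg_mult n x y id = (\<Sum>h\<in>perms n. x (inv h) * y (inv (inv h)))"
    unfolding galg_mult_at_id by (rule sum_perms_inv[symmetric])
  also have "\<dots> = galg_mult n y x id"
    unfolding galg_mult_at_id by (rule sum.cong) (simp_all add: perms_cancel[of _ n] mult.commute)
  finally show ?thesis .
qed

lemma galg_single_sum:
  assumes "x \<in> galg_carrier n"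
  shows "x = (\<Sum>h\<in>perms n. galg_scale (x h) (galg_single h))"
proof
  fix g
  have "(\<Sum>h\<in>perms n. galg_scale (x h) (galg_single h)) g = (\<Sum>h\<in>perms n. if h = g then x g else 0)"
    unfolding sum_fun_apply by (rule sum.cong) (auto simp: galg_scale_def galg_single_def)
  also have "\<dots> = x g"
    using assms by (auto simp: galg_carrier_iff)
  finally show "x g = (\<Sum>h\<in>perms n. galg_scale (x h) (galg_single h)) g" ..
qed

lemma inj_galg_single: "inj_on galg_single A"
  by (rule inj_onI) (metis galg_single_def zero_neq_one)

lemma span_galg_single: "galg.span (galg_single ` perms n) = galg_carrier n"
proof
  have "galg.subspace (galg_carrier n)"
    by (auto simp: galg.subspace_def galg_carrier_iff galg_scale_def)
  moreover have "galg_single ` perms n \<subseteq> galg_carrier n"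
    by (auto simp: galg_carrier_iff galg_single_def)
  ultimately show "galg.span (galg_single ` perms n) \<subseteq> galg_carrier n"
    by (rule galg.span_minimal[rotated])
next
  show "galg_carrier n \<subseteq> galg.span (galg_single ` perms n)"
  proof
    fix x assume "x \<in> galg_carrier n"
    from galg_single_sum[OF this] show "x \<in> galg.span (galg_single ` perms n)"
      using galg.span_sum[of "perms n" "\<lambda>h. galg_scale (x h) (galg_single h)" "galg_single ` perms n"]
      by (simp add: galg.span_scale galg.span_base)
  qed
qed

lemma sum_galg_single_apply:
  assumes "g \<in> perms n"
  shows "(\<Sum>e\<in>galg_single ` perms n. galg_scale (u e) e) g = u (galg_single g)"
proof -
  have "(\<Sum>e\<in>galg_single ` perms n. galg_scale (u e) e) g =
      (\<Sum>h\<in>perms n. galg_scale (u (galg_single h)) (galg_single h) g)"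
    by (simp add: sum.reindex inj_galg_single sum_fun_apply)
  also have "\<dots> = (\<Sum>h\<in>perms n. if h = g then u (galg_single h) else 0)"
    by (rule sum.cong) (auto simp: galg_scale_def galg_single_def)
  also have "\<dots> = u (galg_single g)"
    using assms finite_perms[of n] by simp
  finally show ?thesis .
qed

lemma independent_galg_single: "galg.independent (galg_single ` perms n)"
proof -
  have "u (galg_single g) = 0"
    if "(\<Sum>e\<in>galg_single ` perms n. galg_scale (u e) e) = 0" "g \<in> perms n" for u g
    using sum_galg_single_apply[OF that(2), of u] that(1) by simp
  then show ?thesis
    using finite_perms[of n] by (auto simp: galg.dependent_finite)
qed

lemma representation_galg_single:
  assumes "x \<in> galg_carrier n" "g \<in> perms n"
  shows "galg.representation (galg_single ` perms n) x (galg_single g) = x g"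
proof -
  have "(\<Sum>e\<in>galg_single ` perms n. galg_scale (galg.representation (galg_single ` perms n) x e) e) = x"
    using assms(1) finite_perms[of n]
    by (intro galg.sum_representation_eq independent_galg_single) (auto simp: span_galg_single)
  then show ?thesis
    using sum_galg_single_apply[OF assms(2)] by metis
qed

text \<open>Right multiplication by \<open>c\<close> maps onto the left ideal and acts there as the
  scalar \<open>k\<close>, so the trace can be taken over the basis of group elements. The
  coefficient of \<open>g h c\<close> at \<open>h\<close> is the summand on the right.\<close>

lemma trace_left_ideal:
  assumes c: "galg_mult n c c = galg_scale k c" and g: "g \<in> perms n"
  shows "k * galg.trace_on ((\<lambda>x. galg_mult n x c) ` galg_carrier n) (galg_mult n (galg_single g)) =
    (\<Sum>h\<in>perms n. c (inv h \<circ> inv g \<circ> h))"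
proof -
  let ?E = "galg_single ` perms n" and ?V = "(\<lambda>x. galg_mult n x c) ` galg_carrier n"
  have "k * galg.trace_on ?V (galg_mult n (galg_single g)) =
    (\<Sum>e\<in>?E. galg.representation ?E (galg_mult n (galg_single g) (galg_mult n e c)) e)"
  proof (rule galg.trace_on_eq_trace_comp[where S = "\<lambda>x. galg_mult n x c"])
    show "galg_mult n v c = galg_scale k v" if "v \<in> ?V" for v
      using that by (auto simp: galg_mult_assoc c galg_mult_scale_right)
    show "galg_mult n (galg_single g) v \<in> ?V" if "v \<in> ?V" for v
      using that by (auto simp: galg_mult_assoc [symmetric] galg_mult_in_carrier)
  qed (auto simp: finite_perms independent_galg_single linear_galg_mult_left linear_galg_mult_right
      span_galg_single galg_mult_in_carrier)
  also have "\<dots> = (\<Sum>h\<in>perms n. galg_mult n (galg_single g) (galg_mult n (galg_single h) c) h)"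
    by (simp add: sum.reindex inj_galg_single representation_galg_single galg_mult_in_carrier)
  also have "\<dots> = (\<Sum>h\<in>perms n. c (inv h \<circ> inv g \<circ> h))"
    by (rule sum.cong) (use g in \<open>auto simp: galg_mult_single_left comp_assoc\<close>)
  finally show ?thesis .
qed


section \<open>Rows and columns of a tableau\<close>

lemma sum_list_take_mono: "i \<le> j \<Longrightarrow> sum_list (take i lam) \<le> sum_list (take j (lam :: nat list))"
  by (metis le_add1 le_iff_add sum_list_append take_add)

lemma sum_list_take_le: "sum_list (take i lam) \<le> sum_list (lam :: nat list)"
  by (metis append_take_drop_id le_add1 sum_list_append)

lemma row_of_less_iff:
  assumes "x \<in> {1..sum_list lam}"
  shows "row_of lam x < R \<longleftrightarrow> x \<le> sum_list (take R lam)"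
proof
  \<comment> \<open>A row index satisfying the condition under \<open>LEAST\<close> must exist; the
    length of \<open>lam\<close> serves as a crude one.\<close>
  have "x \<le> sum_list (take (Suc (length lam)) lam)" using assms by simp
  then have *: "x \<le> sum_list (take (Suc (row_of lam x)) lam)"
    unfolding row_of_def by (rule LeastI)
  assume "row_of lam x < R"
  then show "x \<le> sum_list (take R lam)"
    using * sum_list_take_mono[of "Suc (row_of lam x)" R lam] by simp
next
  assume x: "x \<le> sum_list (take R lam)"
  then obtain r where R: "R = Suc r" using assms by (cases R) auto
  then have "row_of lam x \<le> r" unfolding row_of_def using x by (intro Least_le) simp
  then show "row_of lam x < R" using R by simp
qed

lemma row_of_eq_iff:
  assumes "x \<in> {1..sum_list lam}"
  shows "row_of lam x = r \<longleftrightarrow> sum_list (take r lam) < x \<and> x \<le> sum_list (take (Suc r) lam)"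
  using row_of_less_iff[OF assms, of r] row_of_less_iff[OF assms, of "Suc r"] by linarith

lemma row_of_less_length: "x \<in> {1..sum_list lam} \<Longrightarrow> row_of lam x < length lam"
  by (simp add: row_of_less_iff)

lemma eq_row_plus_col:
  assumes "x \<in> {1..sum_list lam}"
  shows "x = sum_list (take (row_of lam x) lam) + col_of lam x"
  using row_of_eq_iff[OF assms, of "row_of lam x"] by (simp add: col_of_def)

lemma row_col_bounds:
  assumes x: "x \<in> {1..sum_list lam}"
  shows "1 \<le> col_of lam x" "col_of lam x \<le> lam ! row_of lam x"
  using row_of_eq_iff[OF x, of "row_of lam x"] row_of_less_length[OF x]
  by (auto simp: col_of_def take_Suc_conv_app_nth)

lemma row_col_inj:
  assumes "x \<in> {1..sum_list lam}" "y \<in> {1..sum_list lam}"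
    "row_of lam x = row_of lam y" "col_of lam x = col_of lam y"
  shows "x = y"
  by (subst eq_row_plus_col[OF assms(1)], subst eq_row_plus_col[OF assms(2)]) (simp only: assms(3,4))

lemma row_col_entry:
  assumes "r < length lam" "1 \<le> c" "c \<le> lam ! r"
  defines "y \<equiv> sum_list (take r lam) + c"
  shows "y \<in> {1..sum_list lam}" "row_of lam y = r" "col_of lam y = c"
proof -
  have le: "y \<le> sum_list (take (Suc r) lam)"
    using assms by (simp add: take_Suc_conv_app_nth)
  then show y: "y \<in> {1..sum_list lam}"
    using sum_list_take_le[of "Suc r" lam] assms(2) by (auto simp: y_def)
  show "row_of lam y = r" using le assms(2) by (simp add: row_of_eq_iff[OF y]) (simp add: y_def)
  then show "col_of lam y = c" by (simp add: col_of_def) (simp add: y_def)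
qed

lemma card_row_less: "card {x\<in>{1..sum_list lam}. row_of lam x < R} = sum_list (take R lam)"
proof -
  have "{x\<in>{1..sum_list lam}. row_of lam x < R} = {1..sum_list (take R lam)}"
    using sum_list_take_le[of R lam] by (auto simp: row_of_less_iff)
  then show ?thesis by simp
qed

lemma card_row_eq:
  assumes "r < length lam"
  shows "card {x\<in>{1..sum_list lam}. row_of lam x = r} = lam ! r"
proof -
  have "x \<in> {1..sum_list lam} \<and> row_of lam x = r \<longleftrightarrow>
      x \<in> {sum_list (take r lam)<..sum_list (take (Suc r) lam)}" for x
  proof (cases "x \<in> {1..sum_list lam}")
    case True
    then show ?thesis using row_of_eq_iff[OF True, of r] by simp
  next
    case False
    then show ?thesis using sum_list_take_le[of "Suc r" lam] by auto
  qed
  then have "{x\<in>{1..sum_list lam}. row_of lam x = r} = {sum_list (take r lam)<..sum_list (take (Suc r) lam)}"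
    by blast
  then show ?thesis using assms by (simp add: take_Suc_conv_app_nth)
qed

text \<open>In a tableau of partition shape, the entries of a column fill an initial segment of rows.\<close>

lemma card_col_row_less:
  assumes lam: "sorted_wrt (\<ge>) lam"
  shows "card {y\<in>{1..sum_list lam}. col_of lam y = c \<and> row_of lam y < R} =
    min (card {y\<in>{1..sum_list lam}. col_of lam y = c}) R"
proof (cases "1 \<le> c")
  case False
  then have none: "col_of lam y \<noteq> c" if "y \<in> {1..sum_list lam}" for y
    using row_col_bounds(1)[OF that] by blast
  have 1: "card {y\<in>{1..sum_list lam}. col_of lam y = c \<and> row_of lam y < R} = 0"
    using none by (intro card_eq_0_iff[THEN iffD2] disjI1) blast
  have 2: "card {y\<in>{1..sum_list lam}. col_of lam y = c} = 0"
    using none by (intro card_eq_0_iff[THEN iffD2] disjI1) blast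
  show ?thesis unfolding 1 2 by simp
next
  case True
  \<comment> \<open>These rows are long enough to reach column \<open>c\<close>. As
    \<open>lam\<close> decreases weakly, they form an initial segment \<open>{..<d}\<close>.\<close>
  define D where "D = {r. r < length lam \<and> c \<le> lam ! r}"
  have down: "s \<in> D" if "r \<in> D" "s \<le> r" for r s
  proof (cases "s = r")
    case False
    then have "lam ! s \<ge> lam ! r"
      using that lam sorted_wrt_nth_less[of "(\<ge>)" lam s r] by (auto simp: D_def)
    then show ?thesis using that by (auto simp: D_def)
  qed (use that in simp)
  have fin: "finite D" by (auto simp: D_def)
  define d where "d = card D"
  have Dd: "D = {..<d}"
  proof (cases "D = {}")
    case False
    define m where "m = Max D"
    have "m \<in> D" "\<And>r. r \<in> D \<Longrightarrow> r \<le> m"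
      unfolding m_def using fin False by (simp_all add: Max_in)
    then have D: "D = {..<Suc m}"
      using down unfolding lessThan_Suc_atMost by blast
    then show ?thesis unfolding d_def by simp
  qed (simp add: d_def)
  have card: "card {y\<in>{1..sum_list lam}. col_of lam y = c \<and> P (row_of lam y)} = card {r\<in>D. P r}" for P
  proof (rule bij_betw_same_card)
    show "bij_betw (row_of lam) {y\<in>{1..sum_list lam}. col_of lam y = c \<and> P (row_of lam y)} {r\<in>D. P r}"
    proof (rule bij_betwI')
      fix r assume "r \<in> {r\<in>D. P r}"
      then have r: "r < length lam" "1 \<le> c" "c \<le> lam ! r" "P r" using True by (auto simp: D_def)
      show "\<exists>y\<in>{y\<in>{1..sum_list lam}. col_of lam y = c \<and> P (row_of lam y)}. r = row_of lam y"
        using row_col_entry[OF r(1-3)] r(4) by (intro bexI[of _ "sum_list (take r lam) + c"]) auto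
    next
      fix y assume "y \<in> {y\<in>{1..sum_list lam}. col_of lam y = c \<and> P (row_of lam y)}"
      then show "row_of lam y \<in> {r\<in>D. P r}"
        using row_of_less_length[of y lam] row_col_bounds(2)[of y lam] by (auto simp: D_def)
    next
      fix x y
      assume "x \<in> {y\<in>{1..sum_list lam}. col_of lam y = c \<and> P (row_of lam y)}"
        "y \<in> {y\<in>{1..sum_list lam}. col_of lam y = c \<and> P (row_of lam y)}"
      then show "(row_of lam x = row_of lam y) = (x = y)"
        using row_col_inj[of x lam y] by auto
    qed
  qed
  have "{r\<in>D. r < R} = {..<min d R}" by (auto simp: Dd)
  then have "card {y\<in>{1..sum_list lam}. col_of lam y = c \<and> row_of lam y < R} = min d R"
    using card[of "\<lambda>r. r < R"] by simp
  moreover have "card {y\<in>{1..sum_list lam}. col_of lam y = c} = d"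
    using card[of "\<lambda>_. True"] by (simp add: Dd)
  ultimately show ?thesis by simp
qed

lemma card_vimage_permutes:
  assumes "g permutes X"
  shows "card {x\<in>X. P (g x)} = card {x\<in>X. P x}"
proof (rule bij_betw_same_card)
  show "bij_betw g {x\<in>X. P (g x)} {x\<in>X. P x}"
  proof (rule bij_betwI')
    fix y assume "y \<in> {x\<in>X. P x}"
    then show "\<exists>x\<in>{x\<in>X. P (g x)}. y = g x"
      using permutes_inverses(1)[OF assms] permutes_in_image[OF permutes_inv[OF assms]]
      by (intro bexI[of _ "inv g y"]) auto
  qed (use assms in \<open>auto simp: permutes_in_image dest: permutes_inj injD\<close>)
qed

section \<open>Permutations that send the entries of each row into different columns\<close>

context
  fixes al lam :: "nat list" and g n
  assumes al: "sum_list al = n" and lam: "sum_list lam = n" "sorted_wrt (\<ge>) lam"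
    and g: "g permutes {1..n}"
    and sep: "\<And>x y. x \<in> {1..n} \<Longrightarrow> y \<in> {1..n} \<Longrightarrow> row_of al x = row_of al y \<Longrightarrow>
      col_of lam (g x) = col_of lam (g y) \<Longrightarrow> x = y"
begin

text \<open>A column receives at most one entry from each row of \<open>al\<close>, hence at most
  \<open>R\<close> from the first \<open>R\<close> rows, and never more than its own length. By
  \<open>card_col_row_less\<close>, the tableau of \<open>lam\<close> attains the smaller of these
  two bounds.\<close>

lemma separated_card_le:
  "card {x\<in>{1..n}. col_of lam (g x) = c \<and> row_of al x < R} \<le>
     card {y\<in>{1..n}. col_of lam y = c \<and> row_of lam y < R}"
proof -
  let ?A = "{x\<in>{1..n}. col_of lam (g x) = c \<and> row_of al x < R}"
  have "card ?A = card (row_of al ` ?A)"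
    using sep by (intro card_image[symmetric] inj_onI) auto
  also have "\<dots> \<le> card {..<R}" by (rule card_mono) auto
  finally have "card ?A \<le> R" by simp
  moreover have "card ?A \<le> card {x\<in>{1..n}. col_of lam (g x) = c}"
    by (rule card_mono) auto
  moreover have "card {x\<in>{1..n}. col_of lam (g x) = c} = card {y\<in>{1..n}. col_of lam y = c}"
    by (rule card_vimage_permutes[OF g])
  ultimately show ?thesis
    using card_col_row_less[OF lam(2), of c R] lam(1) by simp
qed

lemma card_by_column:
  assumes "\<And>x. x \<in> {1..n} \<Longrightarrow> f x \<le> n"
  shows "card {x\<in>{1..n}. P x} = (\<Sum>c\<le>n. card {x\<in>{1..n}. f x = c \<and> P x})"
proof -
  have "card {x\<in>{1..n}. P x} = card (\<Union>c\<in>{..n}. {x\<in>{1..n}. f x = c \<and> P x})"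
    using assms by (intro arg_cong[where f = card]) auto
  also have "\<dots> = (\<Sum>c\<le>n. card {x\<in>{1..n}. f x = c \<and> P x})"
    by (rule card_UN_disjoint) auto
  finally show ?thesis .
qed

lemma col_of_le: "x \<in> {1..n} \<Longrightarrow> col_of lam x \<le> n"
  by (simp add: col_of_def le_diff_conv)

lemma g_in: "x \<in> {1..n} \<Longrightarrow> g x \<in> {1..n}"
  using permutes_in_image[OF g] by blast

lemma separated_row_sums:
  "sum_list (take R al) = (\<Sum>c\<le>n. card {x\<in>{1..n}. col_of lam (g x) = c \<and> row_of al x < R})"
  "sum_list (take R lam) = (\<Sum>c\<le>n. card {y\<in>{1..n}. col_of lam y = c \<and> row_of lam y < R})"
proof -
  show "sum_list (take R al) = (\<Sum>c\<le>n. card {x\<in>{1..n}. col_of lam (g x) = c \<and> row_of al x < R})"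
    using card_row_less[of al R] al card_by_column[of "\<lambda>x. col_of lam (g x)" "\<lambda>x. row_of al x < R"]
      col_of_le g_in by simp
  show "sum_list (take R lam) = (\<Sum>c\<le>n. card {y\<in>{1..n}. col_of lam y = c \<and> row_of lam y < R})"
    using card_row_less[of lam R] lam card_by_column[of "col_of lam" "\<lambda>x. row_of lam x < R"]
      col_of_le by simp
qed

text \<open>Summed over all columns, the bound says that \<open>lam\<close> dominates
  \<open>al\<close>.\<close>

lemma separated_dominated: "sum_list (take R al) \<le> sum_list (take R lam)"
  unfolding separated_row_sums by (intro sum_mono separated_card_le)

text \<open>Equal row sums force equality in every column. Then each row has a cell in the column of
  \<open>g x\<close>, and \<open>p\<close> moves \<open>x\<close> there within its row; what remains
  of \<open>g\<close> preserves columns.\<close>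

lemma separated_factor:
  assumes eq: "al = lam"
  obtains p q where "p \<in> row_group lam" "q \<in> col_group lam" "g = q \<circ> p"
proof -
  have card_eq: "card {x\<in>{1..n}. col_of lam (g x) = c \<and> row_of lam x < R} =
      card {y\<in>{1..n}. col_of lam y = c \<and> row_of lam y < R}" if "c \<le> n" for c R
  proof -
    let ?A = "\<lambda>c. card {x\<in>{1..n}. col_of lam (g x) = c \<and> row_of lam x < R}"
    let ?B = "\<lambda>c. card {y\<in>{1..n}. col_of lam y = c \<and> row_of lam y < R}"
    have "(\<Sum>c\<le>n. ?A c) = (\<Sum>c\<le>n. ?B c)"
      using separated_row_sums[of R] eq by simp
    moreover have "?A c \<le> ?B c" for c
      using separated_card_le[of c R] eq by simp
    ultimately show ?thesis
      using sum_mono_inv[of ?A "{..n}" ?B c] that by simp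
  qed
  \<comment> \<open>The entry \<open>x\<close> makes the count for its column \<open>?c\<close> grow
    between the bounds \<open>?r\<close> and \<open>Suc ?r\<close>. By \<open>card_eq\<close> the
    count for \<open>lam\<close> grows too, so the cell in that row and column exists.\<close>
  have ex: "\<exists>y\<in>{1..n}. row_of lam y = row_of lam x \<and> col_of lam y = col_of lam (g x)" if x: "x \<in> {1..n}" for x
  proof (rule ccontr)
    assume no: "\<not> ?thesis"
    let ?c = "col_of lam (g x)" and ?r = "row_of lam x"
    have c: "?c \<le> n" using col_of_le g_in x by simp
    have "{y\<in>{1..n}. col_of lam y = ?c \<and> row_of lam y < Suc ?r} =
        {y\<in>{1..n}. col_of lam y = ?c \<and> row_of lam y < ?r}"
      using no by (auto simp: less_Suc_eq)
    then have "card {y\<in>{1..n}. col_of lam (g y) = ?c \<and> row_of lam y < Suc ?r} =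
        card {y\<in>{1..n}. col_of lam (g y) = ?c \<and> row_of lam y < ?r}"
      using card_eq[OF c] by simp
    moreover have "card {y\<in>{1..n}. col_of lam (g y) = ?c \<and> row_of lam y < ?r} <
        card {y\<in>{1..n}. col_of lam (g y) = ?c \<and> row_of lam y < Suc ?r}"
      using x by (intro psubset_card_mono) auto
    ultimately show False by simp
  qed
  define p where "p x = (if x \<in> {1..n} then sum_list (take (row_of lam x) lam) + col_of lam (g x) else x)" for x
  have p: "p x \<in> {1..n}" "row_of lam (p x) = row_of lam x" "col_of lam (p x) = col_of lam (g x)"
    if x: "x \<in> {1..n}" for x
  proof -
    obtain y where y: "y \<in> {1..n}" "row_of lam y = row_of lam x" "col_of lam y = col_of lam (g x)"
      using ex[OF x] by blast
    then have "p x = y" using eq_row_plus_col[of y lam, symmetric] x lam(1) by (simp add: p_def)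
    with y show "p x \<in> {1..n}" "row_of lam (p x) = row_of lam x" "col_of lam (p x) = col_of lam (g x)"
      by auto
  qed
  have "inj_on p {1..n}"
  proof (rule inj_onI)
    fix x y assume xy: "x \<in> {1..n}" "y \<in> {1..n}" "p x = p y"
    then show "x = y" using p(2,3)[of x] p(2,3)[of y] sep[of x y] eq by simp
  qed
  moreover have "p ` {1..n} \<subseteq> {1..n}" using p(1) by blast
  ultimately have "bij_betw p {1..n} {1..n}"
    by (simp add: bij_betw_def endo_inj_surj)
  then have pp: "p permutes {1..n}"
    by (rule bij_imp_permutes) (auto simp: p_def)
  have "p \<in> row_group lam" using pp p(2) lam(1) by (simp add: row_group_def)
  moreover have "g \<circ> inv p \<in> col_group lam"
  proof -
    have "col_of lam ((g \<circ> inv p) y) = col_of lam y" if "y \<in> {1..n}" for y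
    proof -
      have "inv p y \<in> {1..n}" using permutes_in_image[OF permutes_inv[OF pp]] that by blast
      then show ?thesis using p(3)[of "inv p y"] permutes_inverses(1)[OF pp] by simp
    qed
    moreover have "g \<circ> inv p permutes {1..n}" using g pp by (intro permutes_compose permutes_inv)
    ultimately show ?thesis using lam(1) by (simp add: col_group_def)
  qed
  moreover have "g = (g \<circ> inv p) \<circ> p"
    using permutes_inv_o(2)[OF pp] by (simp add: comp_assoc)
  ultimately show thesis by (rule that)
qed

end

text \<open>The partial sums first differ where the lists do, so a lexicographically larger list is
  never dominated.\<close>

lemma lexgt_imp_sum_take: "lexgt al lam \<Longrightarrow> \<exists>R. sum_list (take R al) > sum_list (take R lam)"
proof (induction al arbitrary: lam)
  case (Cons a al)
  then obtain b be where lam: "lam = b # be" by (auto split: list.splits)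
  consider "a > b" | "a = b" "lexgt al be" using Cons.prems by (auto simp: lam)
  then show ?case
  proof cases
    case 1
    then show ?thesis by (intro exI[of _ 1]) (simp add: lam)
  next
    case 2
    then obtain R where "sum_list (take R al) > sum_list (take R be)" using Cons.IH by blast
    then show ?thesis using 2 by (intro exI[of _ "Suc R"]) (simp add: lam)
  qed
qed simp


section \<open>Characters of Specht modules\<close>

lemma young_subgroup_compose:
  "p \<in> young_subgroup r X \<Longrightarrow> q \<in> young_subgroup r X \<Longrightarrow> p \<circ> q \<in> young_subgroup r X"
  by (auto simp: young_subgroup_def permutes_compose permutes_in_image)

lemma young_subgroup_inv:
  assumes "p \<in> young_subgroup r X"
  shows "inv p \<in> young_subgroup r X"
proof -
  have p: "p permutes X" "\<And>x. x \<in> X \<Longrightarrow> r (p x) = r x"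
    using assms by (auto simp: young_subgroup_def)
  have "r (inv p x) = r x" if "x \<in> X" for x
    using p(2)[of "inv p x"] that permutes_inverses(1)[OF p(1), of x]
      permutes_in_image[OF permutes_inv[OF p(1)], of x] by simp
  then show ?thesis using permutes_inv[OF p(1)] by (simp add: young_subgroup_def)
qed

lemma young_subgroup_inv_compose_iff:
  assumes p: "p \<in> young_subgroup r X"
  shows "inv p \<circ> g \<in> young_subgroup r X \<longleftrightarrow> g \<in> young_subgroup r X"
    and "g \<circ> inv p \<in> young_subgroup r X \<longleftrightarrow> g \<in> young_subgroup r X"
proof -
  have "p permutes X" using p by (simp add: young_subgroup_def)
  then have eq: "p \<circ> (inv p \<circ> g) = g" "(g \<circ> inv p) \<circ> p = g"
    by (simp_all add: fun_eq_iff permutes_inverses)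
  note closed = young_subgroup_compose young_subgroup_inv[OF p] p
  show "inv p \<circ> g \<in> young_subgroup r X \<longleftrightarrow> g \<in> young_subgroup r X"
    using closed(1)[OF p, of "inv p \<circ> g"] closed(1)[OF closed(2), of g] unfolding eq by blast
  show "g \<circ> inv p \<in> young_subgroup r X \<longleftrightarrow> g \<in> young_subgroup r X"
    using closed(1)[of "g \<circ> inv p", OF _ p] closed(1)[of g, OF _ closed(2)] unfolding eq by blast
qed

lemma row_group_eq: "row_group lam = young_subgroup (row_of lam) {1..sum_list lam}"
  by (simp add: row_group_def young_subgroup_def)

lemma col_group_eq: "col_group lam = young_subgroup (col_of lam) {1..sum_list lam}"
  by (simp add: col_group_def young_subgroup_def)

lemma young_subgroup_subset_perms: "young_subgroup r {1..n} \<subseteq> perms n"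
  by (auto simp: young_subgroup_def perms_def)

lemma sum_galg_single:
  assumes "G \<subseteq> perms n"
  shows "(\<Sum>p\<in>G. galg_scale (u p) (galg_single p)) g = (if g \<in> G then u g else 0)"
proof -
  have "(\<Sum>p\<in>G. galg_scale (u p) (galg_single p)) g = (\<Sum>p\<in>G. if p = g then u g else 0)"
    unfolding sum_fun_apply by (rule sum.cong) (auto simp: galg_scale_def galg_single_def)
  then show ?thesis
    using finite_subset[OF assms] by simp
qed

definition row_sum :: "nat list \<Rightarrow> (nat \<Rightarrow> nat) \<Rightarrow> complex" where
  "row_sum al = (\<Sum>p\<in>row_group al. galg_single p)"

definition col_sum :: "nat list \<Rightarrow> (nat \<Rightarrow> nat) \<Rightarrow> complex" where
  "col_sum lam = (\<Sum>q\<in>col_group lam. galg_scale (of_int (sign q)) (galg_single q))"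

lemma galg_scale_one [simp]: "galg_scale 1 x = x"
  by (simp add: galg_scale_def)

lemma row_group_subset_perms: "row_group al \<subseteq> perms (sum_list al)"
  unfolding row_group_eq by (rule young_subgroup_subset_perms)

lemma col_group_subset_perms: "col_group lam \<subseteq> perms (sum_list lam)"
  unfolding col_group_eq by (rule young_subgroup_subset_perms)

lemma row_sum_apply: "row_sum al g = (if g \<in> row_group al then 1 else 0)"
  using sum_galg_single[OF row_group_subset_perms, of "\<lambda>_. 1" al g]
  by (simp add: row_sum_def)

lemma col_sum_apply: "col_sum lam g = (if g \<in> col_group lam then of_int (sign g) else 0)"
  using sum_galg_single[OF col_group_subset_perms, of "\<lambda>q. of_int (sign q)" lam g]
  by (simp add: col_sum_def)

lemma row_group_perms: "p \<in> row_group al \<Longrightarrow> p \<in> perms (sum_list al)"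
  using row_group_subset_perms by blast

lemma col_group_perms: "q \<in> col_group lam \<Longrightarrow> q \<in> perms (sum_list lam)"
  using col_group_subset_perms by blast

lemma row_sum_single:
  assumes p: "p \<in> row_group al" "sum_list al = n"
  shows "galg_mult n (row_sum al) (galg_single p) = row_sum al"
    "galg_mult n (galg_single p) (row_sum al) = row_sum al"
proof -
  have "p \<in> perms n" using p row_group_perms by blast
  then show "galg_mult n (row_sum al) (galg_single p) = row_sum al"
    "galg_mult n (galg_single p) (row_sum al) = row_sum al"
    using p row_group_perms[of _ al] young_subgroup_inv_compose_iff[of p "row_of al" "{1..n}"]
    by (auto simp: fun_eq_iff galg_mult_single_right galg_mult_single_left row_sum_apply row_group_eq)
qed

lemma single_col_sum:
  assumes q: "q \<in> col_group lam" "sum_list lam = n"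
  shows "galg_mult n (galg_single q) (col_sum lam) = galg_scale (of_int (sign q)) (col_sum lam)"
proof
  fix g
  have qn: "q \<in> perms n" using q col_group_perms by blast
  have "sign (inv q \<circ> g) = sign q * sign g" if "g \<in> perms n"
  proof -
    have "permutation q" "permutation g"
      using qn that by (auto simp: perms_def permutation_permutes)
    then show ?thesis by (simp add: sign_compose sign_inverse permutation_inverse)
  qed
  then show "galg_mult n (galg_single q) (col_sum lam) g = galg_scale (of_int (sign q)) (col_sum lam) g"
    using q qn col_group_perms[of _ lam] young_subgroup_inv_compose_iff[of q "col_of lam" "{1..n}"]
    by (auto simp: galg_mult_single_left col_sum_apply col_group_eq galg_scale_def)
qed

text \<open>A transposition \<open>t\<close> in the row group with \<open>h\<^sup>-\<^sup>1 t h\<close> in the column group shows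
  that \<open>a h b = - a h b\<close>.\<close>

lemma row_single_col_eq_0:
  assumes al: "sum_list al = n" and lam: "sum_list lam = n" and h: "h \<in> perms n"
    and xy: "x \<in> {1..n}" "y \<in> {1..n}" "x \<noteq> y" "row_of al x = row_of al y"
      "col_of lam (inv h x) = col_of lam (inv h y)"
  shows "galg_mult n (row_sum al) (galg_mult n (galg_single h) (col_sum lam)) = 0"
proof -
  have hp: "h permutes {1..n}" using h by (simp add: perms_def)
  let ?t = "transpose x y" and ?u = "transpose (inv h x) (inv h y)"
  have inv_in: "inv h x \<in> {1..n}" "inv h y \<in> {1..n}"
    using permutes_in_image[OF permutes_inv[OF hp]] xy(1,2) by blast+
  have ne: "inv h x \<noteq> inv h y"
    using xy(3) permutes_inj[OF permutes_inv[OF hp]] by (auto dest: injD)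
  have t: "?t \<in> row_group al"
    using xy al by (auto simp: row_group_def transpose_def permutes_swap_id)
  have u: "?u \<in> col_group lam"
    using xy(5) inv_in lam by (auto simp: col_group_def transpose_def permutes_swap_id)
  have th: "?t \<circ> h = h \<circ> ?u"
  proof
    fix z
    have "z = inv h x \<longleftrightarrow> h z = x" "z = inv h y \<longleftrightarrow> h z = y"
      using permutes_inverses[OF hp] by metis+
    then show "(?t \<circ> h) z = (h \<circ> ?u) z"
      using permutes_inverses(1)[OF hp] by (auto simp: transpose_def)
  qed
  have tn: "?t \<in> perms n" "?u \<in> perms n" using row_group_perms[OF t] col_group_perms[OF u] al lam by auto
  let ?P = "galg_mult n (row_sum al) (galg_mult n (galg_single h) (col_sum lam))"
  have "?P = galg_mult n (galg_mult n (row_sum al) (galg_single ?t)) (galg_mult n (galg_single h) (col_sum lam))"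
    by (simp only: row_sum_single[OF t al])
  also have "\<dots> = galg_mult n (row_sum al) (galg_mult n (galg_mult n (galg_single ?t) (galg_single h)) (col_sum lam))"
    by (simp only: galg_mult_assoc)
  also have "galg_mult n (galg_single ?t) (galg_single h) = galg_mult n (galg_single h) (galg_single ?u)"
    using tn h by (simp only: galg_mult_single_single th)
  also have "galg_mult n (galg_mult n (galg_single h) (galg_single ?u)) (col_sum lam) =
      galg_scale (-1) (galg_mult n (galg_single h) (col_sum lam))"
    using ne by (simp only: galg_mult_assoc single_col_sum[OF u lam] galg_mult_scale_right sign_swap_id
        if_False of_int_minus of_int_1)
  also have "galg_mult n (row_sum al) \<dots> = galg_scale (-1) ?P"
    by (simp only: galg_mult_scale_right)
  finally have "?P = galg_scale (-1) ?P" .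
  then have "?P g = - ?P g" for g
    by (metis galg_scale_def mult_minus1)
  then show ?thesis by (simp add: fun_eq_iff)
qed

lemma row_mult_col_linear:
  assumes "x \<in> galg_carrier n"
  shows "galg_mult n a (galg_mult n x b) =
    (\<Sum>h\<in>perms n. galg_scale (x h) (galg_mult n a (galg_mult n (galg_single h) b)))"
proof -
  have "galg_mult n a (galg_mult n x b) =
    galg_mult n a (galg_mult n (\<Sum>h\<in>perms n. galg_scale (x h) (galg_single h)) b)"
    using galg_single_sum[OF assms] by simp
  then show ?thesis
    by (simp only: galg_mult_sum_left galg_mult_sum_right galg_mult_scale_left galg_mult_scale_right)
qed

section \<open>The Young symmetrizer of a partition and its character\<close>

context
  fixes lam :: "nat list" and n :: nat
  assumes lam: "sorted_wrt (\<ge>) lam" "sum_list lam = n"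
begin

private abbreviation "mul \<equiv> galg_mult n"
private abbreviation "a \<equiv> row_sum lam"
private abbreviation "b \<equiv> col_sum lam"
private abbreviation "c \<equiv> young_symmetrizer lam"
private abbreviation "k \<equiv> mul c c id"

lemma young_symmetrizer_eq: "c = mul a b"
  using lam by (simp add: young_symmetrizer_def row_sum_def col_sum_def)

text \<open>If the product were nonzero for some \<open>h\<close>, then by
  \<open>row_single_col_eq_0\<close> its inverse would separate rows of \<open>al\<close> into
  columns of \<open>lam\<close>, and \<open>lam\<close> would dominate \<open>al\<close>.\<close>

lemma row_mult_col_eq_0:
  assumes al: "sum_list al = n" "lexgt al lam" and x: "x \<in> galg_carrier n"
  shows "mul (row_sum al) (mul x b) = 0"
proof -
  have "mul (row_sum al) (mul (galg_single h) b) = 0" if h: "h \<in> perms n" for h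
  proof (rule ccontr)
    assume nz: "mul (row_sum al) (mul (galg_single h) b) \<noteq> 0"
    have "sum_list (take R al) \<le> sum_list (take R lam)" for R
    proof (rule separated_dominated[OF al(1) lam(2,1)])
      show "inv h permutes {1..n}" using h by (simp add: perms_def permutes_inv)
      show "x = y" if "x \<in> {1..n}" "y \<in> {1..n}" "row_of al x = row_of al y"
        "col_of lam (inv h x) = col_of lam (inv h y)" for x y
        using row_single_col_eq_0[OF al(1) lam(2) h that(1,2)] that nz by blast
    qed
    then show False using lexgt_imp_sum_take[OF al(2)] by (meson not_less)
  qed
  then show ?thesis unfolding row_mult_col_linear[OF x] by (simp add: galg_scale_def fun_eq_iff sum_fun_apply)
qed

text \<open>A row and a column share at most one entry, so the row and column groups meet only in
  the identity.\<close>

lemma young_symmetrizer_id: "c id = 1"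
proof -
  have "p = id" if p: "p \<in> row_group lam" "inv p \<in> col_group lam" for p
  proof
    fix x
    have pn: "p \<in> perms n" using row_group_perms[OF p(1)] lam by simp
    then have pp: "p permutes {1..n}" by (simp add: perms_def)
    show "p x = id x"
    proof (cases "x \<in> {1..n}")
      case True
      then have px: "p x \<in> {1..n}" using permutes_in_image[OF pp] by blast
      have "row_of lam (p x) = row_of lam x" using p(1) True lam by (simp add: row_group_def)
      moreover have "col_of lam (inv p (p x)) = col_of lam (p x)"
        using p(2) px lam by (simp add: col_group_def)
      ultimately show ?thesis
        using row_col_inj[of "p x" lam x] True px lam permutes_inverses(2)[OF pp] by simp
    next
      case False
      then show ?thesis using permutes_not_in[OF pp] by simp
    qed
  qed
  moreover have "id \<in> row_group lam" "inv id \<in> col_group lam"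
    by (auto simp: row_group_def col_group_def permutes_id simp flip: id_def)
  ultimately have "a h * b (inv h) = (if h = id then 1 else 0)" for h
    by (auto simp: row_sum_apply col_sum_apply)
  then show ?thesis
    unfolding young_symmetrizer_eq galg_mult_at_id by simp
qed

text \<open>For a single \<open>h\<close> with nonzero product, \<open>separated_factor\<close>
  writes \<open>h\<close> as a row permutation times a column permutation. The outer factors absorb
  both up to sign. The scalar is read off at the identity, where \<open>c\<close> has coefficient
  1.\<close>

lemma row_mult_col_eq_scale:
  assumes x: "x \<in> galg_carrier n"
  shows "mul a (mul x b) = galg_scale (mul a (mul x b) id) c"
proof -
  have "\<exists>s. mul a (mul (galg_single h) b) = galg_scale s c" if h: "h \<in> perms n" for h
  proof (cases "mul a (mul (galg_single h) b) = 0")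
    case True
    then show ?thesis by (intro exI[of _ 0]) (simp add: galg_scale_def fun_eq_iff)
  next
    case False
    have ih: "inv h permutes {1..n}" using h by (simp add: perms_def permutes_inv)
    have sep: "x = y" if "x \<in> {1..n}" "y \<in> {1..n}" "row_of lam x = row_of lam y"
      "col_of lam (inv h x) = col_of lam (inv h y)" for x y
      using row_single_col_eq_0[OF lam(2,2) h that(1,2)] that False by blast
    obtain p q where pq: "p \<in> row_group lam" "q \<in> col_group lam" "inv h = q \<circ> p"
      using separated_factor[OF lam(2,2,1) ih sep refl] by blast
    have pn: "p \<in> perms n" "q \<in> perms n" using row_group_perms[OF pq(1)] col_group_perms[OF pq(2)] lam by auto
    have ip: "inv p \<in> row_group lam" and iq: "inv q \<in> col_group lam"
      using pq young_subgroup_inv by (auto simp: row_group_eq col_group_eq)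
    have "h = inv p \<circ> inv q"
      using pq(3) perms_inv_compose[OF pn(2,1)] perms_cancel(7)[OF h] by simp
    then have "galg_single h = mul (galg_single (inv p)) (galg_single (inv q))"
      using pn by (simp add: galg_mult_single_single)
    then have "mul a (mul (galg_single h) b) =
        mul (mul a (galg_single (inv p))) (mul (galg_single (inv q)) b)"
      by (simp add: galg_mult_assoc)
    also have "\<dots> = galg_scale (of_int (sign (inv q))) c"
      by (simp add: row_sum_single[OF ip lam(2)] single_col_sum[OF iq lam(2)] galg_mult_scale_right
          young_symmetrizer_eq)
    finally show ?thesis by blast
  qed
  then obtain s where s: "\<And>h. h \<in> perms n \<Longrightarrow> mul a (mul (galg_single h) b) = galg_scale (s h) c"
    by metis
  have eq: "mul a (mul x b) = galg_scale (\<Sum>h\<in>perms n. x h * s h) c"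
    unfolding row_mult_col_linear[OF x]
    by (simp add: s fun_eq_iff galg_scale_def sum_fun_apply sum_distrib_right mult.assoc)
  then have "mul a (mul x b) id = (\<Sum>h\<in>perms n. x h * s h)"
    by (simp add: galg_scale_def young_symmetrizer_id)
  with eq show ?thesis by simp
qed

lemma young_symmetrizer_square: "mul c c = galg_scale k c"
proof -
  have "mul c c = mul a (mul (mul b a) b)"
    by (simp add: young_symmetrizer_eq galg_mult_assoc)
  then show ?thesis
    using row_mult_col_eq_scale[OF galg_mult_in_carrier, of b a] by simp
qed

lemma mult_young_symmetrizer_square:
  "mul x (mul c c) = galg_scale k (mul x c)" "mul (mul c c) x = galg_scale k (mul c x)"
  by (subst young_symmetrizer_square, rule galg_mult_scale_right)
    (subst young_symmetrizer_square, rule galg_mult_scale_left)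

text \<open>Since \<open>c = a b\<close>, the product has the form \<open>a y b\<close>. Multiples
  of \<open>c\<close> are thus all that arises, the fact behind norm 1 of the character.\<close>

lemma young_symmetrizer_sandwich: "mul c (mul x c) = galg_scale (mul c (mul x c) id) c"
proof -
  have "mul c (mul x c) = mul a (mul (mul b (mul x a)) b)"
    by (simp add: young_symmetrizer_eq galg_mult_assoc)
  then show ?thesis
    using row_mult_col_eq_scale[OF galg_mult_in_carrier, of b "mul x a"] by simp
qed

lemma specht_character_formula:
  assumes "g \<in> perms n"
  shows "k * specht_character lam g = (\<Sum>h\<in>perms n. c (inv h \<circ> inv g \<circ> h))"
  using trace_left_ideal[OF young_symmetrizer_square assms] lam
  by (simp add: specht_character_def specht_module_def)

text \<open>At the identity all \<open>fact n\<close> summands of the character formula equal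
  1.\<close>

lemma young_symmetrizer_square_id_nonzero: "k \<noteq> 0"
proof -
  have "k * specht_character lam id = (\<Sum>h\<in>perms n. 1)"
    unfolding specht_character_formula[OF perms_id]
    by (rule sum.cong) (auto simp: perms_cancel[of _ n] young_symmetrizer_id)
  also have "\<dots> = fact n"
    by (simp add: perms_def card_permutations)
  finally show ?thesis by (metis fact_nonzero mult_zero_left)
qed

text \<open>The formula sums over all conjugates of \<open>inv g\<close>, so conjugating
  \<open>g\<close> only shifts the summation index; \<open>k\<close> is then cancelled.\<close>

lemma specht_character_conj:
  assumes h: "h \<in> perms n" and g: "g \<in> perms n"
  shows "specht_character lam (h \<circ> g \<circ> inv h) = specht_character lam g"
proof -
  have "k * specht_character lam (h \<circ> g \<circ> inv h) =
      (\<Sum>u\<in>perms n. c (inv u \<circ> inv (h \<circ> g \<circ> inv h) \<circ> u))"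
    using assms by (intro specht_character_formula) simp
  also have "\<dots> = (\<Sum>u\<in>perms n. c (inv (h \<circ> u) \<circ> inv (h \<circ> g \<circ> inv h) \<circ> (h \<circ> u)))"
    by (rule sum_perms_left[OF h, symmetric])
  also have "\<dots> = (\<Sum>u\<in>perms n. c (inv u \<circ> inv g \<circ> u))"
    by (rule sum.cong) (use h g in \<open>simp_all add: perms_inv_compose[of _ n] perms_cancel[OF h] comp_assoc\<close>)
  also have "\<dots> = k * specht_character lam g"
    by (rule specht_character_formula[OF g, symmetric])
  finally show ?thesis using young_symmetrizer_square_id_nonzero by simp
qed

lemma specht_character_real:
  assumes "g \<in> perms n"
  shows "specht_character lam g \<in> \<real>"
proof -
  have c: "c h \<in> \<real>" for h
    by (auto simp: young_symmetrizer_eq galg_mult_apply row_sum_apply col_sum_apply intro!: sum_in_Reals)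
  then have "k \<in> \<real>"
    by (auto simp: galg_mult_at_id intro!: sum_in_Reals Reals_mult)
  moreover have "specht_character lam g = (\<Sum>h\<in>perms n. c (inv h \<circ> inv g \<circ> h)) / k"
    using specht_character_formula[OF assms] young_symmetrizer_square_id_nonzero by (simp add: field_simps)
  ultimately show ?thesis
    using c by (auto intro!: sum_in_Reals Reals_divide)
qed

lemma conj_single_apply:
  assumes "h \<in> perms n" "u \<in> perms n"
  shows "mul (galg_single h) (mul x (galg_single (inv h))) u = x (inv h \<circ> u \<circ> h)"
  using assms by (simp add: galg_mult_single_left galg_mult_single_right perms_cancel[OF assms(1)])

lemma scale_mult_single_at_id:
  "h \<in> perms n \<Longrightarrow> mul (galg_scale s x) (galg_single (inv h)) id = s * x h"
  by (simp add: galg_mult_single_right galg_scale_def perms_cancel[of h n])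

text \<open>Up to \<open>k\<close>, the character is the conjugation sum \<open>Z\<close> of
  \<open>c\<close>. Invariance of \<open>Z\<close> reduces the sum of \<open>Z (inv g) * Z g\<close>
  to \<open>fact n\<close> times the sum over \<open>h\<close> of the coefficients of
  \<open>c h c h^(-1)\<close> at the identity. By the sandwich property each of these is
  \<open>k * c (inv h) * c h\<close>, and together they give \<open>k * k\<close>.\<close>

lemma sum_specht_character_square:
  "(\<Sum>g\<in>perms n. specht_character lam g * specht_character lam (inv g)) = fact n"
proof -
  define Z where "Z u = (\<Sum>h\<in>perms n. c (inv h \<circ> u \<circ> h))" for u
  have Z: "k * specht_character lam g = Z (inv g)" if "g \<in> perms n" for g
    unfolding Z_def by (rule specht_character_formula[OF that])
  have Zconj: "Z (inv (h \<circ> v \<circ> inv h)) = Z (inv v)" if "h \<in> perms n" "v \<in> perms n" for h v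
    using Z[of v] Z[of "h \<circ> v \<circ> inv h"] specht_character_conj[OF that] that by simp
  have sandwich: "mul c (mul (galg_single h) (mul c (galg_single (inv h)))) id = k * c (inv h) * c h"
    if h: "h \<in> perms n" for h
  proof -
    have "mul c (mul (galg_single h) c) id = mul (galg_single h) (mul c c) id"
      by (subst galg_mult_at_id_commute) (simp add: galg_mult_assoc)
    also have "\<dots> = k * c (inv h)"
      using h by (simp add: mult_young_symmetrizer_square galg_scale_def galg_mult_single_left)
    finally have "mul c (mul (galg_single h) c) = galg_scale (k * c (inv h)) c"
      using young_symmetrizer_sandwich[of "galg_single h"] by simp
    then have "mul (mul c (mul (galg_single h) c)) (galg_single (inv h)) id = k * c (inv h) * c h"
      using h by (simp only: scale_mult_single_at_id)
    then show ?thesis by (simp add: galg_mult_assoc)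
  qed
  have "k * k * (\<Sum>g\<in>perms n. specht_character lam g * specht_character lam (inv g)) =
      (\<Sum>g\<in>perms n. (k * specht_character lam g) * (k * specht_character lam (inv g)))"
    by (simp add: sum_distrib_left mult_ac)
  also have "\<dots> = (\<Sum>g\<in>perms n. Z (inv g) * Z g)"
    by (rule sum.cong) (simp_all add: Z perms_cancel[of _ n])
  also have "\<dots> = (\<Sum>g\<in>perms n. \<Sum>h\<in>perms n. Z (inv g) * c (inv h \<circ> g \<circ> h))"
  proof (rule sum.cong)
    fix g
    show "Z (inv g) * Z g = (\<Sum>h\<in>perms n. Z (inv g) * c (inv h \<circ> g \<circ> h))"
      by (simp only: Z_def[of g] sum_distrib_left)
  qed simp
  also have "\<dots> = (\<Sum>h\<in>perms n. \<Sum>g\<in>perms n. Z (inv g) * c (inv h \<circ> g \<circ> h))"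
    by (rule sum.swap)
  also have "\<dots> = (\<Sum>h\<in>perms n. \<Sum>v\<in>perms n. Z (inv v) * c v)"
  proof (rule sum.cong)
    fix h assume h: "h \<in> perms n"
    have "(\<Sum>g\<in>perms n. Z (inv g) * c (inv h \<circ> g \<circ> h)) =
      (\<Sum>v\<in>perms n. Z (inv (h \<circ> v \<circ> inv h)) * c (inv h \<circ> (h \<circ> v \<circ> inv h) \<circ> h))"
      by (rule sum_perms_conj[OF h, symmetric])
    also have "\<dots> = (\<Sum>v\<in>perms n. Z (inv v) * c v)"
    proof (rule sum.cong)
      fix v assume "v \<in> perms n"
      moreover have "inv h \<circ> (h \<circ> v \<circ> inv h) \<circ> h = v"
        by (simp add: comp_assoc perms_cancel[OF h])
      ultimately show "Z (inv (h \<circ> v \<circ> inv h)) * c (inv h \<circ> (h \<circ> v \<circ> inv h) \<circ> h) =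
          Z (inv v) * c v"
        using Zconj[OF h] by metis
    qed simp
    finally show "(\<Sum>g\<in>perms n. Z (inv g) * c (inv h \<circ> g \<circ> h)) = (\<Sum>v\<in>perms n. Z (inv v) * c v)" .
  qed simp
  also have "\<dots> = fact n * (\<Sum>v\<in>perms n. \<Sum>h\<in>perms n. c v * c (inv h \<circ> inv v \<circ> h))"
    by (simp add: Z_def perms_def card_permutations sum_distrib_left mult_ac)
  also have "(\<Sum>v\<in>perms n. \<Sum>h\<in>perms n. c v * c (inv h \<circ> inv v \<circ> h)) =
      (\<Sum>h\<in>perms n. mul c (mul (galg_single h) (mul c (galg_single (inv h)))) id)"
    by (subst sum.swap) (simp add: galg_mult_at_id[of n c] conj_single_apply)
  also have "\<dots> = (\<Sum>h\<in>perms n. k * (c h * c (inv h)))"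
    by (rule sum.cong) (simp_all add: sandwich mult_ac)
  also have "\<dots> = k * k"
    by (simp only: sum_distrib_left [symmetric] galg_mult_at_id)
  finally have "k * k * (\<Sum>g\<in>perms n. specht_character lam g * specht_character lam (inv g)) =
      k * k * fact n"
    by (simp only: mult.commute)
  moreover have "k * k \<noteq> 0"
    using young_symmetrizer_square_id_nonzero by (simp only: mult_eq_0_iff simp_thms)
  ultimately show ?thesis
    by (simp only: mult_cancel_left simp_thms)
qed

text \<open>The sum is rewritten by coefficients at the identity so that the multiplication rules
  for \<open>row_sum al\<close> become applicable.\<close>

lemma sum_row_group_specht_character:
  assumes al: "sum_list al = n"
  shows "k * (\<Sum>r\<in>row_group al. specht_character lam r) =
    (\<Sum>h\<in>perms n. mul (row_sum al) (mul (galg_single h) (mul c (galg_single (inv h)))) id)"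
proof -
  have sub: "row_group al \<subseteq> perms n" using row_group_perms[of _ al] al by auto
  have "k * (\<Sum>r\<in>row_group al. specht_character lam r) =
      (\<Sum>r\<in>row_group al. \<Sum>h\<in>perms n. c (inv h \<circ> inv r \<circ> h))"
    using sub by (simp add: sum_distrib_left specht_character_formula subset_iff)
  also have "\<dots> = (\<Sum>r\<in>perms n. row_sum al r * (\<Sum>h\<in>perms n. c (inv h \<circ> inv r \<circ> h)))"
    by (rule sum.mono_neutral_cong_left) (use sub in \<open>auto simp: row_sum_apply\<close>)
  also have "\<dots> = (\<Sum>h\<in>perms n. \<Sum>r\<in>perms n. row_sum al r * c (inv h \<circ> inv r \<circ> h))"
    unfolding sum_distrib_left by (rule sum.swap)
  also have "\<dots> = (\<Sum>h\<in>perms n. mul (row_sum al) (mul (galg_single h) (mul c (galg_single (inv h)))) id)"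
    by (simp add: galg_mult_at_id[of n "row_sum al"] conj_single_apply)
  finally show ?thesis .
qed

text \<open>Every summand contains a factor \<open>row_sum al * (h a) * b\<close>, which vanishes by
  \<open>row_mult_col_eq_0\<close>.\<close>

lemma sum_row_group_specht_character_lexgt:
  assumes al: "sum_list al = n" "lexgt al lam"
  shows "(\<Sum>r\<in>row_group al. specht_character lam r) = 0"
proof -
  have "mul (row_sum al) (mul (galg_single h) (mul c y)) = 0" for h y
  proof -
    have "mul (row_sum al) (mul (galg_single h) (mul c y)) =
        mul (mul (row_sum al) (mul (mul (galg_single h) a) b)) y"
      by (simp add: young_symmetrizer_eq galg_mult_assoc)
    also have "\<dots> = mul 0 y"
      by (simp only: row_mult_col_eq_0[OF al galg_mult_in_carrier])
    finally show ?thesis by (simp add: fun_eq_iff galg_mult_apply)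
  qed
  then show ?thesis
    using sum_row_group_specht_character[OF al(1)] young_symmetrizer_square_id_nonzero by simp
qed

text \<open>Here \<open>a (h a) b\<close> is a multiple of \<open>c\<close>, with scalar the
  coefficient of \<open>c a\<close> at \<open>inv h\<close>. Summing over \<open>h\<close> gives
  \<open>c c a\<close> at the identity, that is, \<open>k\<close> times the value there of
  \<open>a a b\<close>, and \<open>a a\<close> is the order of the row group times
  \<open>a\<close>.\<close>

lemma sum_row_group_specht_character_self:
  "(\<Sum>r\<in>row_group lam. specht_character lam r) = of_nat (card (row_group lam))"
proof -
  have aa: "mul a a = galg_scale (of_nat (card (row_group lam))) a"
  proof -
    have "mul a a = (\<Sum>p\<in>row_group lam. mul (galg_single p) a)"
      by (simp add: row_sum_def[of lam] galg_mult_sum_left)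
    also have "\<dots> = (\<Sum>p\<in>row_group lam. a)"
      by (rule sum.cong) (simp_all add: row_sum_single lam)
    also have "\<dots> = galg_scale (of_nat (card (row_group lam))) a"
      by (simp add: fun_eq_iff sum_fun_apply galg_scale_def)
    finally show ?thesis .
  qed
  have summand: "mul a (mul (galg_single h) (mul c (galg_single (inv h)))) id = c h * mul c a (inv h)"
    if h: "h \<in> perms n" for h
  proof -
    have "mul a (mul (mul (galg_single h) a) b) id = mul a (mul (galg_single h) c) id"
      by (simp add: young_symmetrizer_eq galg_mult_assoc)
    also have "\<dots> = mul (galg_single h) (mul c a) id"
      by (subst galg_mult_at_id_commute) (simp add: galg_mult_assoc)
    also have "\<dots> = mul c a (inv h)"
      using h by (simp add: galg_mult_single_left)
    finally have "mul a (mul (mul (galg_single h) a) b) = galg_scale (mul c a (inv h)) c"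
      using row_mult_col_eq_scale[OF galg_mult_in_carrier, of "galg_single h" a] by simp
    then have "mul (mul a (mul (mul (galg_single h) a) b)) (galg_single (inv h)) id = mul c a (inv h) * c h"
      using h by (simp only: scale_mult_single_at_id)
    then show ?thesis by (simp add: young_symmetrizer_eq galg_mult_assoc mult.commute)
  qed
  have "k * (\<Sum>r\<in>row_group lam. specht_character lam r) = (\<Sum>h\<in>perms n. c h * mul c a (inv h))"
    unfolding sum_row_group_specht_character[OF lam(2)] by (rule sum.cong) (simp_all add: summand)
  also have "\<dots> = mul (mul c c) a id"
    by (simp add: galg_mult_at_id[symmetric] galg_mult_assoc)
  also have "\<dots> = k * mul c a id"
    by (simp only: mult_young_symmetrizer_square galg_scale_def)
  also have "mul c a id = mul (mul a a) b id"
    by (subst galg_mult_at_id_commute) (simp add: young_symmetrizer_eq galg_mult_assoc)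
  also have "\<dots> = of_nat (card (row_group lam))"
    by (simp add: aa galg_mult_scale_left young_symmetrizer_eq[symmetric])
      (simp add: galg_scale_def young_symmetrizer_id)
  finally show ?thesis
    using young_symmetrizer_square_id_nonzero by (simp only: mult_cancel_left simp_thms)
qed

end


section \<open>The recursion\<close>

lemma msplit_Reals: "(\<And>A B. G A B \<in> \<real>) \<Longrightarrow> msplit G M \<in> (\<real> :: 'b::real_algebra_1 set)"
  by (induction M arbitrary: G) (auto simp: msplit_add_mset)

text \<open>The final comparison adds up squares rather than absolute squares, so it concludes only
  for real values; \<open>specht_character_real\<close> provides the other half.\<close>

lemma frobenius_Reals: "frobenius lam M \<in> (\<real> :: complex set)"
proof (induction lam arbitrary: M)
  case (Cons m lam)
  have "skew (-1) i (frobenius lam) B \<in> (\<real> :: complex set)" for i B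
    unfolding skew_def pavg_def by (auto intro!: sum_in_Reals Reals_divide Reals_mult Cons.IH)
  then show ?case
    unfolding frobenius.simps bernstein_def by (intro msplit_Reals) auto
qed simp

lemma ctype_inv: "finite X \<Longrightarrow> p permutes X \<Longrightarrow> ctype X (inv p) = ctype X p"
  unfolding ctype_def
  by (intro arg_cong[where f = "\<lambda>S. image_mset card (mset_set S)"] image_cong orbit_inv_eq refl)
    (auto simp: permutation_permutes)

lemma sum_row_group_ctype:
  assumes "sum_list al = n"
  shows "(\<Sum>p\<in>row_group al. f (ctype {1..n} p)) = of_nat (card (row_group al)) * hpair al f"
proof -
  have "map (\<lambda>k. card {x\<in>{1..n}. row_of al x = k}) [0..<length al] = al"
    unfolding assms[symmetric] by (rule nth_equalityI) (simp_all only: card_row_eq length_map length_upt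
        nth_map_upt add_0 diff_zero)
  moreover have "row_of al ` {1..n} \<subseteq> set [0..<length al]"
    using assms row_of_less_length[of _ al] by auto
  ultimately show ?thesis
    using sum_young_subgroup_ctype[of "{1..n}" "[0..<length al]" "row_of al" f] assms
    by (simp add: row_group_eq)
qed

lemma specht_character_eq_frobenius:
  assumes lam: "sorted_wrt (\<ge>) lam" "sum_list lam = n" and g: "g \<in> perms n"
  shows "specht_character lam g = frobenius lam (cycle_type n g)"
proof -
  let ?F = "frobenius lam :: nat multiset \<Rightarrow> complex"
  \<comment> \<open>The character is turned into a function of cycle types. The choice is harmless
    because permutations of equal cycle type are conjugate.\<close>
  define f where "f M = specht_character lam (SOME g. g \<in> perms n \<and> ctype {1..n} g = M)" for M
  have f: "f (ctype {1..n} p) = specht_character lam p" if p: "p \<in> perms n" for p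
  proof -
    define q where "q = (SOME g. g \<in> perms n \<and> ctype {1..n} g = ctype {1..n} p)"
    have "q \<in> perms n \<and> ctype {1..n} q = ctype {1..n} p"
      unfolding q_def by (rule someI[of _ p]) (use p in simp)
    then have q: "q \<in> perms n" "ctype {1..n} p = ctype {1..n} q" by simp_all
    then obtain h where h: "h permutes {1..n}" "h \<circ> p = q \<circ> h"
      using conjugate_if_ctype_eq[of "{1..n}" p q] p by (auto simp: perms_def)
    then have hn: "h \<in> perms n" by (simp add: perms_def)
    have "h \<circ> p \<circ> inv h = q"
      unfolding h(2) by (simp add: comp_assoc perms_cancel[OF hn])
    then have "specht_character lam q = specht_character lam p"
      using specht_character_conj[OF lam hn p] by simp
    then show ?thesis by (simp add: f_def q_def)
  qed
  have sum_perms: "(\<Sum>p\<in>perms n. u (ctype {1..n} p)) = fact n * pavg n u" for u :: "nat multiset \<Rightarrow> complex"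
    using sum_permutes_ctype[of "{1..n}" u] by (simp add: perms_def)
  have row: "of_nat (card (row_group al)) * hpair al f = (\<Sum>r\<in>row_group al. specht_character lam r)"
    if "sum_list al = n" for al
  proof -
    have "(\<Sum>r\<in>row_group al. f (ctype {1..n} r)) = (\<Sum>r\<in>row_group al. specht_character lam r)"
      using row_group_perms[of _ al] that by (intro sum.cong refl f) simp
    then show ?thesis using sum_row_group_ctype[OF that, of f] by simp
  qed
  have card: "of_nat (card (row_group al)) \<noteq> (0 :: complex)" for al
  proof -
    have "id \<in> row_group al" by (simp add: row_group_def permutes_id)
    moreover have "finite (row_group al)" using row_group_subset_perms finite_perms by (rule finite_subset)
    ultimately show ?thesis by (auto simp: card_eq_0_iff)
  qed
  have fF: "pavg n (\<lambda>M. f M * ?F M) = 1"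
  proof -
    have "pavg n (\<lambda>M. f M * ?F M) = hpair lam f"
    proof (rule pavg_frobenius[OF lam(2)])
      fix al assume al: "sum_list al = n" "lexgt al lam"
      then show "hpair al f = 0"
        using row[OF al(1)] sum_row_group_specht_character_lexgt[OF lam al] card[of al] by simp
    qed
    also have "\<dots> = 1"
      using row[OF lam(2)] sum_row_group_specht_character_self[OF lam] card[of lam] by simp
    finally show ?thesis .
  qed
  have FF: "pavg n (\<lambda>M. ?F M * ?F M) = 1"
    using pavg_frobenius[OF lam(2) hpair_frobenius_lexgt[OF lam(1)]] hpair_frobenius_self[OF lam(1)]
    by metis
  have ff: "pavg n (\<lambda>M. f M * f M) = 1"
  proof -
    \<comment> \<open>A permutation and its inverse have the same cycle type, so the sum of
      \<open>f M * f M\<close> can be matched with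
      \<open>sum_specht_character_square\<close>.\<close>
    have "fact n * pavg n (\<lambda>M. f M * f M) = (\<Sum>p\<in>perms n. f (ctype {1..n} p) * f (ctype {1..n} (inv p)))"
      unfolding sum_perms[symmetric] by (rule sum.cong) (simp_all add: ctype_inv perms_def)
    also have "\<dots> = (\<Sum>p\<in>perms n. specht_character lam p * specht_character lam (inv p))"
      by (rule sum.cong) (simp_all only: f perms_inv)
    also have "\<dots> = fact n"
      by (rule sum_specht_character_square[OF lam])
    finally show ?thesis by simp
  qed
  let ?d = "\<lambda>p. specht_character lam p - ?F (ctype {1..n} p)"
  have "pavg n (\<lambda>M. (f M - ?F M)\<^sup>2) =
      pavg n (\<lambda>M. f M * f M) - 2 * pavg n (\<lambda>M. f M * ?F M) + pavg n (\<lambda>M. ?F M * ?F M)"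
    unfolding pavg_mult_left[symmetric] pavg_diff[symmetric] pavg_add[symmetric]
    by (simp add: power2_eq_square algebra_simps)
  also have "\<dots> = 0" by (simp add: ff fF FF)
  finally have "(\<Sum>p\<in>perms n. (f (ctype {1..n} p) - ?F (ctype {1..n} p))\<^sup>2) = 0"
    using sum_perms[of "\<lambda>M. (f M - ?F M)\<^sup>2"] by simp
  moreover have "(\<Sum>p\<in>perms n. (f (ctype {1..n} p) - ?F (ctype {1..n} p))\<^sup>2) = (\<Sum>p\<in>perms n. (?d p)\<^sup>2)"
    by (rule sum.cong) (simp_all only: f)
  ultimately have "(\<Sum>p\<in>perms n. (?d p)\<^sup>2) = 0"
    by (simp only:)
  moreover have d: "?d p = of_real (Re (?d p))" if "p \<in> perms n" for p
    using specht_character_real[OF lam that] frobenius_Reals[of lam "ctype {1..n} p"]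
    by (intro of_real_Re[symmetric] Reals_diff)
  ultimately have "(\<Sum>p\<in>perms n. of_real ((Re (?d p))\<^sup>2)) = (0 :: complex)"
    by (metis (mono_tags, lifting) of_real_power sum.cong)
  then have "(\<Sum>p\<in>perms n. (Re (?d p))\<^sup>2) = 0"
    unfolding of_real_sum[symmetric] of_real_eq_0_iff .
  then have "Re (?d g) = 0"
    using g by (subst (asm) sum_nonneg_eq_0_iff) auto
  then show ?thesis
    using d[OF g] by (simp add: cycle_type_conv_ctype)
qed

text \<open>A permutation of cycle type \<open>rho\<close> exists, so the choice in
  \<open>chi\<close> picks a genuine representative.\<close>

lemma chi_eq_frobenius:
  assumes lam: "lam \<in> partitions n" and rho: "rho \<in> partitions n"
  shows "chi lam rho = frobenius lam (mset rho)"
proof -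
  have sum: "sum_list lam = n" "sorted_wrt (\<ge>) lam" using lam by (auto simp: partitions_def)
  have "mset rho \<in> pmsets n"
    using bij_betw_apply[OF bij_betw_mset_partitions rho] .
  then obtain g where "g permutes {1..n}" "ctype {1..n} g = mset rho"
    using ex_permutes_ctype[of "{1..n}" "mset rho"] by auto
  then have "\<exists>g. g permutes {1..n} \<and> cycle_type n g = mset rho"
    by (auto simp: cycle_type_conv_ctype)
  from someI_ex[OF this] show ?thesis
    using specht_character_eq_frobenius[OF sum(2,1)] by (simp add: chi_def sum(1) perms_def)
qed

lemma mset_nths_Compl: "mset (nths xs I) + mset (nths xs (- I)) = mset xs"
proof (induction xs arbitrary: I)
  case (Cons x xs)
  have "{j. Suc j \<in> - I} = - {j. Suc j \<in> I}" by auto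
  then show ?case
    using Cons.IH[of "{j. Suc j \<in> I}"] by (simp add: nths_Cons)
qed simp

theorem theorem3p10:
  fixes n :: nat and lam rho :: "nat list"
  assumes "n \<ge> 1" and "lam \<in> partitions n" and "rho \<in> partitions n"
  shows "chi lam rho =
    (\<Sum>I | I \<subseteq> {..<length rho} \<and> sum_list (nths rho I) \<ge> hd lam.
       \<Sum>tau\<in>partitions (sum_list (nths rho I) - hd lam).
         (-1) ^ length tau / of_nat (part_z tau) *
           chi (tl lam) (part_union (nths rho (- I)) tau))"
proof -
  obtain m l where lam: "lam = m # l"
    using assms(1,2) by (cases lam) (auto simp: partitions_def)
  let ?K = "\<lambda>A B. if m \<le> sum_mset A then skew (-1) (sum_mset A - m) (frobenius l) B else (0 :: complex)"
  \<comment> \<open>The remaining parts together with \<open>tau\<close> form a partition of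
    \<open>n - m\<close>, the weight of \<open>l\<close>; this is what allows passing from
    \<open>frobenius l\<close> back to \<open>chi l\<close>.\<close>
  have summand: "(-1) ^ length tau * frobenius l (mset (nths rho (- I)) + mset tau) / of_nat (part_z tau) =
      (-1) ^ length tau / of_nat (part_z tau) * chi l (part_union (nths rho (- I)) tau)"
    if I: "m \<le> sum_list (nths rho I)" and tau: "tau \<in> partitions (sum_list (nths rho I) - m)" for I tau
  proof -
    have "sum_list (nths rho I) + sum_list (nths rho (- I)) = n"
      using arg_cong[OF mset_nths_Compl[of rho I], of sum_mset] assms(3)
      by (simp add: sum_mset_sum_list partitions_def)
    then have "sum_list (part_union (nths rho (- I)) tau) = n - m"
      using I tau unfolding sum_mset_sum_list[symmetric]
      by (simp add: part_union_def partitions_def sum_mset_sum_list)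
    moreover have "0 \<notin> set (nths rho (- I))"
      using assms(3) in_set_nthsD[of 0 rho] by (auto simp: partitions_def)
    ultimately have "part_union (nths rho (- I)) tau \<in> partitions (n - m)"
      using tau by (simp add: partitions_def part_union_def sorted_wrt_rev)
    moreover have "l \<in> partitions (n - m)"
      using assms(2) by (auto simp: lam partitions_def)
    ultimately have "chi l (part_union (nths rho (- I)) tau) = frobenius l (mset (nths rho (- I)) + mset tau)"
      by (simp add: chi_eq_frobenius) (simp add: part_union_def)
    then show ?thesis by simp
  qed
  \<comment> \<open>A single unfolding of \<open>frobenius\<close> at the first row is already the
    recursion; the rest translates splittings into sets of positions.\<close>
  have "chi lam rho = msplit ?K (mset rho)"
    unfolding chi_eq_frobenius[OF assms(2,3)] by (simp add: lam bernstein_def)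
  also have "\<dots> = (\<Sum>I | I \<subseteq> {..<length rho}. ?K (mset (nths rho I)) (mset (nths rho (- I))))"
    by (rule msplit_mset)
  also have "\<dots> = (\<Sum>I | I \<subseteq> {..<length rho} \<and> sum_list (nths rho I) \<ge> m.
      skew (-1) (sum_list (nths rho I) - m) (frobenius l) (mset (nths rho (- I))))"
    by (rule sum.mono_neutral_cong_right) (auto simp: sum_mset_sum_list)
  also have "\<dots> = (\<Sum>I | I \<subseteq> {..<length rho} \<and> sum_list (nths rho I) \<ge> m.
      \<Sum>tau\<in>partitions (sum_list (nths rho I) - m).
         (-1) ^ length tau / of_nat (part_z tau) * chi l (part_union (nths rho (- I)) tau))"
    unfolding skew_def pavg_partitions by (intro sum.cong refl) (simp_all add: summand)
  finally show ?thesis by (simp add: lam)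
qed

end
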